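(* Let $k$ be a field of characteristic zero, $n\ge 1$ an integer, $G\subset S_n$ a subgroup, and $M$ a right $G$-module over $k$. Let $A=k[x_1,\dots,x_n]$ be the polynomial coalgebra and let $C(A)^{(1,\dots,1)}$ be the multidegree $(1,\dots,1)$ part of its cobar complex, on which $S_n$ (hence $G$) acts by permuting the variables $x_1,\dots,x_n$. Then $$H\big(M\otimes_G C(A)^{(1,\dots,1)}\big)\cong M\otimes_G \mathrm{sgn}_n,$$ where $\mathrm{sgn}_n$ is the one-dimensional sign representation of $G$ (the restriction to $G$ of the sign representation of $S_n$), concentrated in degree $n$.
   Context: The polynomial coalgebra $A=k[x_1,\dots,x_n]$ is the polynomial algebra with the coproduct $\Delta:A\to A\otimes A$ that is the algebra homomorphism with $\Delta(x_i)=x_i\otimes 1+1\otimes x_i$. The cobar complex $C(A)$ has degree-$m$ part $A^{\otimes m}$ ($m\ge 0$) and differential $A^{\otimes m}\to A^{\otimes (m+1)}$, $$d(a_1\otimes\cdots\otimes a_m)=1\otimes a_1\otimes\cdots\otimes a_m+\sum_{i=1}^m(-1)^i a_1\otimes\cdots\otimes\Delta(a_i)\otimes\cdots\otimes a_m+(-1)^{m+1}a_1\otimes\cdots\otimes a_m\otimes 1.$$ $C(A)$ is $\mathbb{N}_0^n$-graded by the total numbers of occurrences of $x_1,\dots,x_n$, and $C(A)^{(1,\dots,1)}$ is the subcomplex of multidegree $(1,\dots,1)$. Its degree-$m$ part is canonically $(k^m)^{\otimes n}$, where $e_{j_1}\otimes\cdots\otimes e_{j_n}$ corresponds to the tensor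 in which $x_i$ is placed in the $j_i$-th tensor factor for each $i$. The left action of $\sigma\in S_n$ by $x_i\mapsto x_{\sigma(i)}$ corresponds to permuting the $n$ factors of $(k^m)^{\otimes n}$ and commutes with $d$. The complex $M\otimes_G C(A)^{(1,\dots,1)}$ (tensor product over $k[G]$, differential induced by $d$) is called the cubical complex $\mathit{Cub}(G,M)$ of the pair $(G,M)$. *)

theory Defs
  imports
    "HOL-Algebra.Sym_Groups"
    "HOL-Algebra.Algebraic_Closure_Type"
    "HOL-Library.Poly_Mapping"
    "HOL-Library.Product_Plus"
begin

section \<open>Linear algebra over a field given as a type\<close>

text \<open>
  Vector spaces over \<open>'k\<close> are records of type \<open>('k, 'v) module\<close>; the scalar ring is
  \<^const>\<open>ring_of_type_algebra\<close>. The ring fields \<open>mult\<close> and \<open>one\<close>, which such records inherit,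
  carry no information and are filled with dummy values.
\<close>

definition linear_maps :: "('k, 'v) module \<Rightarrow> ('k, 'w) module \<Rightarrow> ('v \<Rightarrow> 'w) set" where
  "linear_maps V W = {f \<in> carrier V \<rightarrow> carrier W.
     (\<forall>x\<in>carrier V. \<forall>y\<in>carrier V. f (x \<oplus>\<^bsub>V\<^esub> y) = f x \<oplus>\<^bsub>W\<^esub> f y) \<and>
     (\<forall>c. \<forall>x\<in>carrier V. f (c \<odot>\<^bsub>V\<^esub> x) = c \<odot>\<^bsub>W\<^esub> f x)}"

definition linearly_isomorphic :: "('k, 'v) module \<Rightarrow> ('k, 'w) module \<Rightarrow> bool" where
  "linearly_isomorphic V W \<longleftrightarrow> (\<exists>f\<in>linear_maps V W. bij_betw f (carrier V) (carrier W))"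

text \<open>As for \<^const>\<open>FactRing\<close>, operations on cosets are unions over all representatives.\<close>

definition quotient_module :: "('k, 'v) module \<Rightarrow> 'v set \<Rightarrow> ('k, 'v set) module" where
  "quotient_module V W =
    \<lparr>carrier = a_rcosets\<^bsub>V\<^esub> W, mult = (\<lambda>_ _. W), one = W, zero = W, add = set_add V,
     module.smult = (\<lambda>c Q. \<Union>x\<in>Q. W +>\<^bsub>V\<^esub> (c \<odot>\<^bsub>V\<^esub> x))\<rparr>"

text \<open>
  The free vector space on a set \<open>B\<close> consists of finitely supported functions; the basis vector
  belonging to \<open>x \<in> B\<close> is \<^term>\<open>Poly_Mapping.single x 1\<close>.
\<close>

abbreviation basis_vec :: "'b \<Rightarrow> 'b \<Rightarrow>\<^sub>0 'k::field" where
  "basis_vec x \<equiv> Poly_Mapping.single x 1"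

definition scale :: "'k::field \<Rightarrow> ('b \<Rightarrow>\<^sub>0 'k) \<Rightarrow> 'b \<Rightarrow>\<^sub>0 'k" where
  "scale c p = Poly_Mapping.map ((*) c) p"

definition free_module :: "'b set \<Rightarrow> ('k::field, 'b \<Rightarrow>\<^sub>0 'k) module" where
  "free_module B =
    \<lparr>carrier = {p. Poly_Mapping.keys p \<subseteq> B}, mult = (\<lambda>_ _. 0), one = 0, zero = 0, add = (+),
     module.smult = scale\<rparr>"

definition linear_extension :: "('b \<Rightarrow> 'c \<Rightarrow>\<^sub>0 'k) \<Rightarrow> ('b \<Rightarrow>\<^sub>0 'k::field) \<Rightarrow> 'c \<Rightarrow>\<^sub>0 'k" where
  "linear_extension f p = (\<Sum>x\<in>Poly_Mapping.keys p. scale (Poly_Mapping.lookup p x) (f x))"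


section \<open>Modules over a group and their tensor product\<close>

locale right_group_module = group H + module ring_of_type_algebra M
  for H :: "('g, 'z) monoid_scheme" and M :: "('k::field, 'm) module" +
  fixes ract :: "'m \<Rightarrow> 'g \<Rightarrow> 'm"
  assumes ract_linear: "g \<in> carrier H \<Longrightarrow> (\<lambda>x. ract x g) \<in> linear_maps M M"
    and ract_one: "x \<in> carrier M \<Longrightarrow> ract x \<one>\<^bsub>H\<^esub> = x"
    and ract_mult: "\<lbrakk>x \<in> carrier M; g \<in> carrier H; h \<in> carrier H\<rbrakk>
        \<Longrightarrow> ract x (g \<otimes>\<^bsub>H\<^esub> h) = ract (ract x g) h"

text \<open>
  For a right \<open>G\<close>-module \<open>M\<close> and a left \<open>G\<close>-module \<open>V\<close>, the tensor product over \<open>k[G]\<close> is the free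
  vector space on pairs \<open>(x, v)\<close> modulo \<open>k\<close>-bilinearity and \<open>(x g, v) = (x, g v)\<close>.
\<close>

definition tensor_relators ::
  "'g set \<Rightarrow> ('k::field, 'm) module \<Rightarrow> ('m \<Rightarrow> 'g \<Rightarrow> 'm) \<Rightarrow>
   ('k, 'v) module \<Rightarrow> ('g \<Rightarrow> 'v \<Rightarrow> 'v) \<Rightarrow> ('m \<times> 'v \<Rightarrow>\<^sub>0 'k) set" where
  "tensor_relators G M ract V lact =
     {basis_vec (x \<oplus>\<^bsub>M\<^esub> y, v) - basis_vec (x, v) - basis_vec (y, v) | x y v.
        x \<in> carrier M \<and> y \<in> carrier M \<and> v \<in> carrier V} \<union>
     {basis_vec (x, v \<oplus>\<^bsub>V\<^esub> w) - basis_vec (x, v) - basis_vec (x, w) | x v w.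
        x \<in> carrier M \<and> v \<in> carrier V \<and> w \<in> carrier V} \<union>
     {basis_vec (c \<odot>\<^bsub>M\<^esub> x, v) - scale c (basis_vec (x, v)) | c x v.
        x \<in> carrier M \<and> v \<in> carrier V} \<union>
     {basis_vec (x, c \<odot>\<^bsub>V\<^esub> v) - scale c (basis_vec (x, v)) | c x v.
        x \<in> carrier M \<and> v \<in> carrier V} \<union>
     {basis_vec (ract x g, v) - basis_vec (x, lact g v) | x g v.
        x \<in> carrier M \<and> g \<in> G \<and> v \<in> carrier V}"

definition tensor_relations ::
  "'g set \<Rightarrow> ('k::field, 'm) module \<Rightarrow> ('m \<Rightarrow> 'g \<Rightarrow> 'm) \<Rightarrow>
   ('k, 'v) module \<Rightarrow> ('g \<Rightarrow> 'v \<Rightarrow> 'v) \<Rightarrow> ('m \<times> 'v \<Rightarrow>\<^sub>0 'k) set" where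
  "tensor_relations G M ract V lact =
     (\<lambda>R. submodule R ring_of_type_algebra (free_module (carrier M \<times> carrier V)))
       hull (tensor_relators G M ract V lact)"

definition group_tensor ::
  "'g set \<Rightarrow> ('k::field, 'm) module \<Rightarrow> ('m \<Rightarrow> 'g \<Rightarrow> 'm) \<Rightarrow>
   ('k, 'v) module \<Rightarrow> ('g \<Rightarrow> 'v \<Rightarrow> 'v) \<Rightarrow> ('k, ('m \<times> 'v \<Rightarrow>\<^sub>0 'k) set) module" where
  "group_tensor G M ract V lact =
     quotient_module (free_module (carrier M \<times> carrier V)) (tensor_relations G M ract V lact)"

text \<open>
  The map into \<open>M \<otimes>\<^bsub>G\<^esub> W\<close> induced by a linear equivariant map \<open>f\<close> with target \<open>W\<close>, sending the
  class of \<open>(x, v)\<close> to the class of \<open>(x, f v)\<close>.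
\<close>

definition group_tensor_map ::
  "'g set \<Rightarrow> ('k::field, 'm) module \<Rightarrow> ('m \<Rightarrow> 'g \<Rightarrow> 'm) \<Rightarrow>
   ('k, 'w) module \<Rightarrow> ('g \<Rightarrow> 'w \<Rightarrow> 'w) \<Rightarrow> ('v \<Rightarrow> 'w) \<Rightarrow>
   ('m \<times> 'v \<Rightarrow>\<^sub>0 'k) set \<Rightarrow> ('m \<times> 'w \<Rightarrow>\<^sub>0 'k) set" where
  "group_tensor_map G M ract W lact f Q =
     (\<Union>p\<in>Q. tensor_relations G M ract W lact +>\<^bsub>free_module (carrier M \<times> carrier W)\<^esub>
        linear_extension (\<lambda>(x, v). basis_vec (x, f v)) p)"


section \<open>Cohomology of a cochain complex\<close>

definition coboundaries ::
  "(nat \<Rightarrow> ('k, 'v) module) \<Rightarrow> (nat \<Rightarrow> 'v \<Rightarrow> 'v) \<Rightarrow> nat \<Rightarrow> 'v set" where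
  "coboundaries N d m = (case m of 0 \<Rightarrow> {\<zero>\<^bsub>N 0\<^esub>} | Suc j \<Rightarrow> d j ` carrier (N j))"

definition cohomology ::
  "(nat \<Rightarrow> ('k, 'v) module) \<Rightarrow> (nat \<Rightarrow> 'v \<Rightarrow> 'v) \<Rightarrow> nat \<Rightarrow> ('k, 'v set) module" where
  "cohomology N d m =
     quotient_module ((N m)\<lparr>carrier := a_kernel (N m) (N (Suc m)) (d m)\<rparr>) (coboundaries N d m)"

definition concentrated_in :: "nat \<Rightarrow> ('k, 'v) module \<Rightarrow> nat \<Rightarrow> ('k, 'v) module" where
  "concentrated_in n V m = (if m = n then V else V\<lparr>carrier := {\<zero>\<^bsub>V\<^esub>}\<rparr>)"


section \<open>The polynomial coalgebra\<close>

text \<open>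
  A monomial is its exponent vector \<open>u :: nat \<Rightarrow>\<^sub>0 nat\<close>, so that \<open>k[x\<^sub>1, x\<^sub>2, \<dots>]\<close> is the monoid algebra
  \<open>(nat \<Rightarrow>\<^sub>0 nat) \<Rightarrow>\<^sub>0 'k\<close>. The tensor square of this algebra is the monoid algebra of
  the product monoid, whose element \<open>(u, v)\<close> stands for \<open>x\<^sup>u \<otimes> x\<^sup>v\<close>.
\<close>

type_synonym monomial = "nat \<Rightarrow>\<^sub>0 nat"

definition poly_var :: "nat \<Rightarrow> monomial \<Rightarrow>\<^sub>0 'k::field" where
  "poly_var i = basis_vec (Poly_Mapping.single i 1)"

definition comult_monomial :: "monomial \<Rightarrow> monomial \<times> monomial \<Rightarrow>\<^sub>0 'k::field" where
  "comult_monomial u = (\<Prod>i\<in>Poly_Mapping.keys u.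
     (basis_vec (Poly_Mapping.single i 1, 0) + basis_vec (0, Poly_Mapping.single i 1))
       ^ Poly_Mapping.lookup u i)"

definition comult :: "(monomial \<Rightarrow>\<^sub>0 'k::field) \<Rightarrow> monomial \<times> monomial \<Rightarrow>\<^sub>0 'k" where
  "comult = linear_extension comult_monomial"

lemma lookup_scale [simp]: "Poly_Mapping.lookup (scale c p) x = c * Poly_Mapping.lookup p x"
  by (simp add: scale_def Poly_Mapping.map.rep_eq when_def)

lemma scale_0 [simp]: "scale 0 p = 0" "scale c 0 = 0"
  by (auto intro!: poly_mapping_eqI)

lemma scale_1 [simp]: "scale 1 p = p"
  by (auto intro!: poly_mapping_eqI)

lemma scale_add: "scale (a + b) p = scale a p + scale b p"
  by (auto intro!: poly_mapping_eqI simp: lookup_add algebra_simps)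

lemma scale_conv_times:
  fixes p :: "'b::comm_monoid_add \<Rightarrow>\<^sub>0 'k::field"
  shows "scale c p = Poly_Mapping.single 0 c * p"
proof -
  have "Poly_Mapping.single 0 c * p = Poly_Mapping.map ((*) c) p"
    by (rule mult_map_scale_conv_mult [symmetric])
  then show ?thesis by (simp add: scale_def)
qed

lemma linear_extension_superset:
  assumes "finite A" "Poly_Mapping.keys p \<subseteq> A"
  shows "linear_extension f p = (\<Sum>x\<in>A. scale (Poly_Mapping.lookup p x) (f x))"
  unfolding linear_extension_def
  using assms by (intro sum.mono_neutral_left) (auto simp: in_keys_iff)

lemma linear_extension_single [simp]: "linear_extension f (Poly_Mapping.single x c) = scale c (f x)"
  by (subst linear_extension_superset [of "{x}"]) auto

lemma linear_extension_add:
  "linear_extension f (p + q) = linear_extension f p + linear_extension f q"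
proof -
  let ?A = "Poly_Mapping.keys p \<union> Poly_Mapping.keys q"
  have "Poly_Mapping.keys (p + q) \<subseteq> ?A" by (rule Poly_Mapping.keys_add)
  then show ?thesis
    by (simp add: linear_extension_superset [of ?A] lookup_add scale_add sum.distrib)
qed

lemma poly_mapping_additive_induct [case_names single add]:
  assumes "\<And>x c. P (Poly_Mapping.single x c)" "\<And>p q. P p \<Longrightarrow> P q \<Longrightarrow> P (p + q)"
  shows "P (p :: 'b \<Rightarrow>\<^sub>0 'k::field)"
proof (induction p rule: update_induct)
  case const
  show ?case using assms(1) [of undefined 0] by simp
next
  case (update f a b)
  then have "Poly_Mapping.update a b f = f + Poly_Mapping.single a b"
    by (auto intro!: poly_mapping_eqI simp: lookup_update lookup_add lookup_single in_keys_iff when_def)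
  with update assms show ?case by simp
qed

lemma comult_monomial_add:
  "comult_monomial (u + v) = (comult_monomial u * comult_monomial v
     :: monomial \<times> monomial \<Rightarrow>\<^sub>0 'k::field)"
proof -
  define b :: "nat \<Rightarrow> monomial \<times> monomial \<Rightarrow>\<^sub>0 'k" where
    "b i = basis_vec (Poly_Mapping.single i 1, 0) + basis_vec (0, Poly_Mapping.single i 1)" for i
  let ?A = "Poly_Mapping.keys u \<union> Poly_Mapping.keys v"
  have *: "comult_monomial w = (\<Prod>i\<in>?A. b i ^ Poly_Mapping.lookup w i)"
    if "Poly_Mapping.keys w \<subseteq> ?A" for w
    unfolding comult_monomial_def b_def [symmetric]
    using that by (intro prod.mono_neutral_left) (auto simp: in_keys_iff)
  show ?thesis
    using Poly_Mapping.keys_add [of u v]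
    by (simp add: * lookup_add power_add prod.distrib)
qed

text \<open>\<^const>\<open>comult\<close> is the unital algebra homomorphism determined by its values on the variables.\<close>

lemma comult_const: "comult (Poly_Mapping.single 0 c) = Poly_Mapping.single 0 c"
  by (simp add: comult_def comult_monomial_def scale_conv_times)

lemma comult_one: "comult 1 = 1"
  using comult_const [of 1] by (simp only: single_one)

lemma comult_add: "comult (p + q) = comult p + comult q"
  by (simp add: comult_def linear_extension_add)

lemma comult_var:
  "comult (poly_var i) =
     basis_vec (Poly_Mapping.single i 1, 0) + basis_vec (0, Poly_Mapping.single i 1)"
  by (simp add: comult_def poly_var_def comult_monomial_def)

lemma comult_mult:
  fixes p q :: "monomial \<Rightarrow>\<^sub>0 'k::field"
  shows "comult (p * q) = comult p * comult q"
proof (induction p rule: poly_mapping_additive_induct)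
  case (single u a)
  show ?case
  proof (induction q rule: poly_mapping_additive_induct)
    case (single v b)
    have "comult (Poly_Mapping.single u a * Poly_Mapping.single v b) =
        Poly_Mapping.single 0 (a * b) * (comult_monomial u * comult_monomial v)"
      by (simp add: comult_def mult_single comult_monomial_add scale_conv_times)
    also have "\<dots> = (Poly_Mapping.single 0 a * Poly_Mapping.single 0 b) *
        (comult_monomial u * comult_monomial v)"
      by (simp add: mult_single)
    also have "\<dots> = comult (Poly_Mapping.single u a) * comult (Poly_Mapping.single v b)"
      by (simp add: comult_def scale_conv_times ac_simps)
    finally show ?case .
  qed (simp_all add: distrib_left comult_add)
qed (simp_all add: distrib_right comult_add)


section \<open>The cobar complex\<close>

text \<open>
  The tensor power \<open>A\<^sup>\<otimes>\<^sup>m\<close> of \<open>A = k[x\<^sub>1, \<dots>, x\<^sub>n]\<close> is the free vector space on the lists of \<open>m\<close>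
  monomials; the list \<open>[u\<^sub>1, \<dots>, u\<^sub>m]\<close> stands for the tensor of these monomials, and the exponent
  vector \<open>0\<close> is the unit of \<open>A\<close>.
\<close>

definition cobar_basis :: "nat \<Rightarrow> nat \<Rightarrow> monomial list set" where
  "cobar_basis n m = {us. length us = m \<and> (\<forall>u\<in>set us. Poly_Mapping.keys u \<subseteq> {1..n})}"

definition cobar :: "nat \<Rightarrow> nat \<Rightarrow> ('k::field, monomial list \<Rightarrow>\<^sub>0 'k) module" where
  "cobar n m = free_module (cobar_basis n m)"

definition cobar_diff_basis :: "monomial list \<Rightarrow> monomial list \<Rightarrow>\<^sub>0 'k::field" where
  "cobar_diff_basis us =
     basis_vec (0 # us)
     + (\<Sum>i<length us. scale ((-1) ^ Suc i)
          (linear_extension (\<lambda>(v, w). basis_vec (take i us @ [v, w] @ drop (Suc i) us))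
             (comult (basis_vec (us ! i)))))
     + scale ((-1) ^ Suc (length us)) (basis_vec (us @ [0]))"

definition cobar_diff :: "(monomial list \<Rightarrow>\<^sub>0 'k::field) \<Rightarrow> monomial list \<Rightarrow>\<^sub>0 'k" where
  "cobar_diff = linear_extension cobar_diff_basis"

text \<open>The multidegree of a tensor of monomials is the sum of the exponent vectors.\<close>

definition cobar_part ::
  "nat \<Rightarrow> monomial \<Rightarrow> nat \<Rightarrow> ('k::field, monomial list \<Rightarrow>\<^sub>0 'k) module" where
  "cobar_part n \<alpha> m =
     (cobar n m)\<lparr>carrier := {p \<in> carrier (cobar n m). \<forall>us\<in>Poly_Mapping.keys p. sum_list us = \<alpha>}\<rparr>"

definition all_ones :: "nat \<Rightarrow> monomial" where
  "all_ones n = (\<Sum>i\<in>{1..n}. Poly_Mapping.single i 1)"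

text \<open>The left action of a permutation by \<open>x\<^sub>i \<mapsto> x\<^bsub>\<sigma>(i)\<^esub>\<close>.\<close>

definition rename_vars :: "(nat \<Rightarrow> nat) \<Rightarrow> monomial \<Rightarrow> monomial" where
  "rename_vars \<sigma> u =
     (\<Sum>i\<in>Poly_Mapping.keys u. Poly_Mapping.single (\<sigma> i) (Poly_Mapping.lookup u i))"

definition cobar_act ::
  "(nat \<Rightarrow> nat) \<Rightarrow> (monomial list \<Rightarrow>\<^sub>0 'k::field) \<Rightarrow> monomial list \<Rightarrow>\<^sub>0 'k" where
  "cobar_act \<sigma> = linear_extension (\<lambda>us. basis_vec (map (rename_vars \<sigma>) us))"


section \<open>The cubical complex\<close>

definition Cub ::
  "nat \<Rightarrow> (nat \<Rightarrow> nat) set \<Rightarrow> ('k::field, 'm) module \<Rightarrow> ('m \<Rightarrow> (nat \<Rightarrow> nat) \<Rightarrow> 'm) \<Rightarrow>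
   nat \<Rightarrow> ('k, ('m \<times> (monomial list \<Rightarrow>\<^sub>0 'k) \<Rightarrow>\<^sub>0 'k) set) module" where
  "Cub n G M ract m = group_tensor G M ract (cobar_part n (all_ones n) m) cobar_act"

definition Cub_diff ::
  "nat \<Rightarrow> (nat \<Rightarrow> nat) set \<Rightarrow> ('k::field, 'm) module \<Rightarrow> ('m \<Rightarrow> (nat \<Rightarrow> nat) \<Rightarrow> 'm) \<Rightarrow>
   nat \<Rightarrow> ('m \<times> (monomial list \<Rightarrow>\<^sub>0 'k) \<Rightarrow>\<^sub>0 'k) set \<Rightarrow> ('m \<times> (monomial list \<Rightarrow>\<^sub>0 'k) \<Rightarrow>\<^sub>0 'k) set" where
  "Cub_diff n G M ract m =
     group_tensor_map G M ract (cobar_part n (all_ones n) (Suc m)) cobar_act cobar_diff"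


section \<open>The sign representation\<close>

definition sgn_module :: "('k::field, 'k) module" where
  "sgn_module = \<lparr>carrier = UNIV, mult = (*), one = 1, zero = 0, add = (+), module.smult = (*)\<rparr>"

definition sgn_act :: "(nat \<Rightarrow> nat) \<Rightarrow> 'k::field \<Rightarrow> 'k" where
  "sgn_act \<sigma> c = of_int (sign \<sigma>) * c"

end

theory Submission
  imports Defs
begin

text \<open>
  Write the cobar differential as a signed derivation of the tensor algebra: on a word of monomials,
  \<open>d (u \<otimes> w) = D u \<otimes> w - u \<otimes> d w\<close> with \<open>D u = 1 \<otimes> u - \<Delta> u + u \<otimes> 1\<close>. In multidegree \<open>(1, \<dots>, 1)\<close> a
  single variable \<open>x\<close> can be contracted: let \<open>P\<close> (\<open>block_del\<close>) delete the block containing \<open>x\<close>, with the sign of its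
  position, if that block is exactly \<open>x\<close>, and annihilate the word otherwise, and let \<open>h\<close>
  (\<open>block_htp\<close>) delete the block \<open>x\<close> in the same way and sum over all ways of multiplying \<open>x\<close> into one
  of the preceding blocks. Then
  \<open>P d = - d P\<close> and \<open>d h + h d = 1 - x \<otimes> P\<close>. Contracting all variables one after the other, and finally the
  words of units, gives a homotopy from the identity to the projection onto the line spanned by
  \<open>x\<^sub>1 \<otimes> \<dots> \<otimes> x\<^sub>n\<close>. The operators \<open>P\<close> for different variables anticommute, so the coefficient
  functional of this projection transforms under permutations by the sign. In characteristic zero
  the homotopy can be averaged over \<open>S\<^sub>n\<close>; it is then equivariant and descends to
  \<open>M \<otimes>\<^bsub>G\<^esub> C(A)\<^bsup>(1,\<dots>,1)\<^esup>\<close>.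
\<close>

section \<open>Linear extensions\<close>

text \<open>The formula for h reflects that x is primitive: on two blocks standing before the block
  x, it multiplies by x \<otimes> 1 + 1 \<otimes> x and so carries \<Delta> u to \<Delta> (u x).
  Only the unit terms of D u leave a defect, from which x \<otimes> P arises. P anticommutes with d
  by the counit laws: among the terms of \<Delta> (v x), x stands alone once on the left and once on
  the right, in positions of opposite sign. Multidegree one is essential: on the one-block word x^2
  one has P d = -2 x, but d P = 0.

  The contraction depends on the chosen order of the variables, so its homotopy is not equivariant,
  whereas the tensor product over G can be applied only to equivariant maps. Averaging repairs this
  and requires n! to be invertible. The line spanned by the sorted word is not stable under
  permutations either; averaging replaces the word by its antisymmetrization, while the coefficient
  functional already transforms by the sign. Since the result is a homotopy and not merely a
  computation of cohomology, its identities pass through the tensor product without any exactness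
  argument.\<close>

abbreviation lext :: "('b \<Rightarrow> 'c \<Rightarrow>\<^sub>0 'k) \<Rightarrow> ('b \<Rightarrow>\<^sub>0 'k::field) \<Rightarrow> 'c \<Rightarrow>\<^sub>0 'k" where
  "lext \<equiv> linear_extension"

lemma scale_add_right: "scale c (p + q) = scale c p + scale c q"
  by (auto intro!: poly_mapping_eqI simp: lookup_add algebra_simps)

lemma scale_diff_right: "scale c (p - q) = scale c p - scale c q"
  by (intro poly_mapping_eqI) (simp add: lookup_minus right_diff_distrib)

lemma scale_uminus_right: "scale c (- p) = - scale c p"
  by (auto intro!: poly_mapping_eqI)

lemma scale_minus_1: "scale (- 1) p = - p"
  by (auto intro!: poly_mapping_eqI)

lemma scale_uminus: "scale (- c) p = - scale c p"
  by (auto intro!: poly_mapping_eqI)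

lemma scale_scale: "scale c (scale d p) = scale (c * d) p"
  by (auto intro!: poly_mapping_eqI)

lemma scale_commute: "scale c (scale d p) = scale d (scale c p)"
  by (simp add: scale_scale mult.commute)

lemma scale_sum_right: "scale c (\<Sum>i\<in>I. p i) = (\<Sum>i\<in>I. scale c (p i))"
  by (induction I rule: infinite_finite_induct) (simp_all add: scale_add_right)

lemma scale_single: "scale c (Poly_Mapping.single x b) = Poly_Mapping.single x (c * b)"
  by (auto intro!: poly_mapping_eqI simp: lookup_single when_def)

lemma keys_scale: "Poly_Mapping.keys (scale c p) \<subseteq> Poly_Mapping.keys p"
  by (auto simp: in_keys_iff)

lemmas scale_simps = scale_add_right scale_diff_right scale_uminus_right scale_minus_1 scale_uminus

lemma lext_0 [simp]: "lext f 0 = 0"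
  by (simp add: linear_extension_def)

lemma lext_basis_vec [simp]: "lext basis_vec p = p"
  by (induction p rule: poly_mapping_additive_induct) (simp_all add: linear_extension_add scale_single)

lemma lext_scale: "lext f (scale c p) = scale c (lext f p)"
  by (induction p rule: poly_mapping_additive_induct)
    (simp_all add: linear_extension_add scale_single scale_add_right scale_scale)

lemma lext_uminus: "lext f (- p) = - lext f p"
  using lext_scale [of f "-1" p] by (simp add: scale_minus_1)

lemma lext_diff: "lext f (p - q) = lext f p - lext f q"
  using linear_extension_add [of f p "- q"] by (simp add: lext_uminus)

lemma lext_sum: "lext f (\<Sum>i\<in>I. p i) = (\<Sum>i\<in>I. lext f (p i))"
  by (induction I rule: infinite_finite_induct) (simp_all add: linear_extension_add)

lemma lext_lext: "lext f (lext g p) = lext (\<lambda>x. lext f (g x)) p"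
  by (induction p rule: poly_mapping_additive_induct) (simp_all add: linear_extension_add lext_scale)

lemma lext_fun_add: "lext (\<lambda>x. f x + g x) p = lext f p + lext g p"
  by (simp add: linear_extension_def scale_add_right sum.distrib)

lemma lext_fun_diff: "lext (\<lambda>x. f x - g x) p = lext f p - lext g p"
  by (simp add: linear_extension_def scale_diff_right sum_subtractf)

lemma lext_fun_uminus: "lext (\<lambda>x. - f x) p = - lext f p"
  by (simp add: linear_extension_def scale_uminus_right sum_negf)

lemma lext_fun_0 [simp]: "lext (\<lambda>x. 0) p = 0"
  by (simp add: linear_extension_def)

lemma lext_fun_scale: "lext (\<lambda>x. scale c (f x)) p = scale c (lext f p)"
  by (simp add: linear_extension_def scale_sum_right scale_commute)

lemma lext_cong: "(\<And>x. x \<in> Poly_Mapping.keys p \<Longrightarrow> f x = g x) \<Longrightarrow> lext f p = lext g p"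
  by (simp add: linear_extension_def)

lemma lext_eq_0: "(\<And>x. x \<in> Poly_Mapping.keys p \<Longrightarrow> f x = 0) \<Longrightarrow> lext f p = 0"
  by (simp add: linear_extension_def)

lemma keys_sum_subset:
  "(\<And>i. i \<in> I \<Longrightarrow> Poly_Mapping.keys (p i) \<subseteq> A) \<Longrightarrow> Poly_Mapping.keys (\<Sum>i\<in>I. p i) \<subseteq> A"
proof (induction I rule: infinite_finite_induct)
  case (insert i I)
  then show ?case using Poly_Mapping.keys_add [of "p i" "\<Sum>i\<in>I. p i"] by auto
qed auto

lemma keys_lext_subset:
  assumes "\<And>x. x \<in> Poly_Mapping.keys p \<Longrightarrow> Poly_Mapping.keys (f x) \<subseteq> A"
  shows "Poly_Mapping.keys (lext f p) \<subseteq> A"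
  unfolding linear_extension_def
proof (rule keys_sum_subset)
  fix x assume "x \<in> Poly_Mapping.keys p"
  then show "Poly_Mapping.keys (scale (Poly_Mapping.lookup p x) (f x)) \<subseteq> A"
    by (intro order_trans [OF keys_scale] assms)
qed

lemma keys_add_subset:
  "Poly_Mapping.keys p \<subseteq> A \<Longrightarrow> Poly_Mapping.keys q \<subseteq> A \<Longrightarrow> Poly_Mapping.keys (p + q) \<subseteq> A"
  using Poly_Mapping.keys_add [of p q] by blast

lemma keys_uminus: "Poly_Mapping.keys (- p) = Poly_Mapping.keys (p :: 'b \<Rightarrow>\<^sub>0 'k::field)"
  by (auto simp: in_keys_iff)

lemma keys_diff_subset:
  fixes p q :: "'b \<Rightarrow>\<^sub>0 'k::field"
  shows "Poly_Mapping.keys p \<subseteq> A \<Longrightarrow> Poly_Mapping.keys q \<subseteq> A \<Longrightarrow> Poly_Mapping.keys (p - q) \<subseteq> A"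
  using keys_add_subset [of p A "- q"] by (simp add: keys_uminus)

lemma times_basis_vec:
  fixes p :: "'b::comm_monoid_add \<Rightarrow>\<^sub>0 'k::field"
  shows "p * basis_vec a = lext (\<lambda>b. basis_vec (b + a)) p"
  by (induction p rule: poly_mapping_additive_induct)
    (simp_all add: linear_extension_add distrib_right mult_single scale_single)


section \<open>The coproduct on monomials\<close>

text \<open>Adding one variable at a time matches the recursion of the coproduct, \<Delta> (u x_i) =
  \<Delta> u (x_i \<otimes> 1 + 1 \<otimes> x_i).\<close>

lemma monomial_induct [case_names zero add]:
  assumes "P 0" "\<And>u i. P u \<Longrightarrow> P (u + Poly_Mapping.single i 1)"
  shows "P (u :: monomial)"
proof (induction u rule: update_induct)
  case (update f a b)
  have "P (f + Poly_Mapping.single a c)" for c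
  proof (induction c)
    case (Suc c)
    have "f + Poly_Mapping.single a (Suc c)
        = f + Poly_Mapping.single a c + Poly_Mapping.single a 1"
      by (simp add: add.assoc flip: single_add)
    then show ?case using assms(2) [OF Suc] by simp
  qed (simp add: update)
  moreover from update have "Poly_Mapping.update a b f = f + Poly_Mapping.single a b"
    by (auto intro!: poly_mapping_eqI simp: lookup_update lookup_add lookup_single in_keys_iff when_def)
  ultimately show ?case by simp
qed (fact assms(1))

lemma comult_monomial_0: "comult_monomial 0 = basis_vec (0, 0)"
  by (simp add: comult_monomial_def flip: zero_prod_def)

text \<open>Multiplicativity of the coproduct and primitivity of x_i. Products appear as
  relabellings of the basis because the later arguments inspect single terms.\<close>

lemma comult_monomial_add_var:
  "comult_monomial (u + Poly_Mapping.single i 1) =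
     lext (\<lambda>z. basis_vec (fst z + Poly_Mapping.single i 1, snd z)) (comult_monomial u) +
     lext (\<lambda>z. basis_vec (fst z, snd z + Poly_Mapping.single i 1)) (comult_monomial u
         :: monomial \<times> monomial \<Rightarrow>\<^sub>0 'k::field)"
proof -
  have "comult_monomial (Poly_Mapping.single i 1) =
      (basis_vec (Poly_Mapping.single i 1, 0) + basis_vec (0, Poly_Mapping.single i 1)
        :: monomial \<times> monomial \<Rightarrow>\<^sub>0 'k)"
    by (simp add: comult_monomial_def)
  then show ?thesis
    unfolding comult_monomial_add
    by (simp add: distrib_left times_basis_vec plus_prod_def)
qed

lemma keys_comult_monomial:
  "z \<in> Poly_Mapping.keys (comult_monomial u :: _ \<Rightarrow>\<^sub>0 'k::field) \<Longrightarrow> fst z + snd z = u"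
proof -
  have "Poly_Mapping.keys (comult_monomial u :: _ \<Rightarrow>\<^sub>0 'k) \<subseteq> {z. fst z + snd z = u}"
  proof (induction u rule: monomial_induct)
    case (add u i)
    show ?case
      unfolding comult_monomial_add_var
      using add by (intro keys_add_subset keys_lext_subset) (auto simp: ac_simps)
  qed (auto simp: comult_monomial_0)
  then show "z \<in> Poly_Mapping.keys (comult_monomial u :: _ \<Rightarrow>\<^sub>0 'k) \<Longrightarrow> fst z + snd z = u"
    by blast
qed

lemma add_single_neq_0: "(u :: monomial) + Poly_Mapping.single i 1 \<noteq> 0"
  by (metis add_is_0 lookup_add lookup_single_eq lookup_zero one_neq_zero)

text \<open>The counit law (\<epsilon> \<otimes> 1) \<Delta> = 1, read on terms. Terms that receive
  x_i on the left vanish; in the others x_i is absorbed into \<open>f\<close>, which must therefore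
  stay arbitrary in the induction.\<close>

lemma comult_counit_left: "lext (\<lambda>z. if fst z = 0 then f (snd z) else 0) (comult_monomial u) = f u"
proof (induction u arbitrary: f rule: monomial_induct)
  case (add u i)
  show ?case
    unfolding comult_monomial_add_var linear_extension_add lext_lext
    using add [of "\<lambda>w. f (w + Poly_Mapping.single i 1)"]
    by (simp add: add_single_neq_0 del: One_nat_def cong: if_cong)
qed (simp add: comult_monomial_0)

lemma comult_counit_right: "lext (\<lambda>z. if snd z = 0 then f (fst z) else 0) (comult_monomial u) = f u"
proof (induction u arbitrary: f rule: monomial_induct)
  case (add u i)
  show ?case
    unfolding comult_monomial_add_var linear_extension_add lext_lext
    using add [of "\<lambda>w. f (w + Poly_Mapping.single i 1)"]
    by (simp add: add_single_neq_0 del: One_nat_def cong: if_cong)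
qed (simp add: comult_monomial_0)


section \<open>The cobar differential as a derivation\<close>

definition prepend :: "monomial \<Rightarrow> (monomial list \<Rightarrow>\<^sub>0 'k::field) \<Rightarrow> monomial list \<Rightarrow>\<^sub>0 'k" where
  "prepend u = lext (\<lambda>us. basis_vec (u # us))"

definition prepend2 ::
  "(monomial \<times> monomial \<Rightarrow>\<^sub>0 'k::field) \<Rightarrow> (monomial list \<Rightarrow>\<^sub>0 'k) \<Rightarrow> monomial list \<Rightarrow>\<^sub>0 'k" where
  "prepend2 q p = lext (\<lambda>z. prepend (fst z) (prepend (snd z) p)) q"

text \<open>The differential of the one-block word \<open>u\<close>; unless \<open>u\<close> is the
  unit, this is minus the reduced coproduct.\<close>

definition bidiff :: "monomial \<Rightarrow> monomial \<times> monomial \<Rightarrow>\<^sub>0 'k::field" where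
  "bidiff u = basis_vec (0, u) - comult_monomial u + basis_vec (u, 0)"

lemma prepend_basis_vec [simp]: "prepend u (basis_vec us) = basis_vec (u # us)"
  by (simp add: prepend_def)

lemma prepend_linear:
  "prepend u 0 = 0"
  "prepend u (p + q) = prepend u p + prepend u q"
  "prepend u (p - q) = prepend u p - prepend u q"
  "prepend u (- p) = - prepend u p"
  "prepend u (scale c p) = scale c (prepend u p)"
  "prepend u (\<Sum>i\<in>I. r i) = (\<Sum>i\<in>I. prepend u (r i))"
  by (simp_all add: prepend_def linear_extension_add lext_diff lext_uminus lext_scale lext_sum)

lemma lext_prepend: "lext f (prepend u p) = lext (\<lambda>us. f (u # us)) p"
  by (simp add: prepend_def lext_lext)

lemma prepend_lext: "prepend u (lext f p) = lext (\<lambda>x. prepend u (f x)) p"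
  by (simp add: prepend_def lext_lext)

lemma prepend2_basis_vec [simp]: "prepend2 (basis_vec (v, w)) p = prepend v (prepend w p)"
  by (simp add: prepend2_def)

lemma prepend2_linear:
  "prepend2 q 0 = 0"
  "prepend2 (q + q') p = prepend2 q p + prepend2 q' p"
  "prepend2 (q - q') p = prepend2 q p - prepend2 q' p"
  "prepend2 q (p + p') = prepend2 q p + prepend2 q p'"
  "prepend2 q (p - p') = prepend2 q p - prepend2 q p'"
  "prepend2 q (- p) = - prepend2 q p"
  by (simp_all add: prepend2_def linear_extension_add lext_diff prepend_linear lext_fun_add
      lext_fun_diff lext_fun_uminus)

lemma prepend2_lext: "prepend2 (lext f q) p = lext (\<lambda>z. prepend2 (f z) p) q"
  by (simp add: prepend2_def lext_lext)

lemma cobar_diff_basis_Nil: "cobar_diff_basis [] = 0"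
  by (simp add: cobar_diff_basis_def scale_minus_1)

text \<open>The summand u \<otimes> 1 of \<open>bidiff u\<close> cancels the unit that the
  differential of \<open>us\<close> puts in front, which becomes an interior position after
  prepending \<open>u\<close>. The other faces of \<open>us\<close> move up by one index, whence the
  sign.\<close>

lemma cobar_diff_basis_Cons:
  "cobar_diff_basis (u # us) =
     (prepend2 (bidiff u) (basis_vec us) - prepend u (cobar_diff_basis us) :: _ \<Rightarrow>\<^sub>0 'k::field)"
proof -
  let ?t = "\<lambda>us i. scale ((-1) ^ Suc i)
          (lext (\<lambda>(v, w). basis_vec (take i us @ [v, w] @ drop (Suc i) us))
             (comult (basis_vec (us ! i)))) :: monomial list \<Rightarrow>\<^sub>0 'k"
  have comult: "comult (basis_vec u) = (comult_monomial u :: _ \<Rightarrow>\<^sub>0 'k)" for u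
    by (simp add: comult_def)
  have "?t (u # us) (Suc i) = - prepend u (?t us i)" for i
    by (simp add: prepend_linear prepend_lext scale_simps case_prod_unfold)
  moreover have "?t (u # us) 0 = - prepend2 (comult_monomial u) (basis_vec us)"
    by (simp add: comult prepend2_def scale_simps case_prod_unfold)
  ultimately have "(\<Sum>i<length (u # us). ?t (u # us) i) =
      - prepend2 (comult_monomial u) (basis_vec us) - prepend u (\<Sum>i<length us. ?t us i)"
    by (simp only: list.size add_0_right add_Suc_right sum.lessThan_Suc_shift prepend_linear sum_negf
        diff_conv_add_uminus)
  then show ?thesis
    unfolding cobar_diff_basis_def bidiff_def
    by (simp add: prepend2_linear prepend_linear scale_simps)
qed

lemma cobar_diff_linear:
  "cobar_diff 0 = 0"
  "cobar_diff (p + q) = cobar_diff p + cobar_diff q"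
  "cobar_diff (p - q) = cobar_diff p - cobar_diff q"
  "cobar_diff (- p) = - cobar_diff p"
  "cobar_diff (scale c p) = scale c (cobar_diff p)"
  "cobar_diff (\<Sum>i\<in>I. r i) = (\<Sum>i\<in>I. cobar_diff (r i))"
  by (simp_all add: cobar_diff_def linear_extension_add lext_diff lext_uminus lext_scale lext_sum)

lemma cobar_diff_prepend:
  "cobar_diff (prepend u p) = prepend2 (bidiff u) p - prepend u (cobar_diff p)"
proof (induction p rule: poly_mapping_additive_induct)
  case (single us c)
  have "Poly_Mapping.single us c = scale c (basis_vec us)"
    by (simp add: scale_single)
  then show ?case
    by (simp add: cobar_diff_def cobar_diff_basis_Cons prepend_linear prepend2_def lext_scale
        scale_diff_right lext_fun_scale)
next
  case (add p q)
  then show ?case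
    by (simp add: cobar_diff_def linear_extension_add prepend_linear prepend2_linear)
qed


section \<open>Contracting one variable\<close>

text \<open>Deleting a block has degree -1, so passing a block costs a Koszul sign; this makes
  deletions anticommute with the differential and with each other.\<close>

fun block_del :: "nat \<Rightarrow> monomial list \<Rightarrow> monomial list \<Rightarrow>\<^sub>0 'k::field" where
  "block_del x [] = 0"
| "block_del x (u # us) =
     (if Poly_Mapping.lookup u x = 0 then - prepend u (block_del x us)
      else if u = Poly_Mapping.single x 1 then basis_vec us else 0)"

text \<open>If the first block contains x, no earlier block can receive it, hence the value
  0.\<close>

fun block_htp :: "nat \<Rightarrow> monomial list \<Rightarrow> monomial list \<Rightarrow>\<^sub>0 'k::field" where
  "block_htp x [] = 0"
| "block_htp x (u # us) =
     (if Poly_Mapping.lookup u x = 0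
      then - prepend (u + Poly_Mapping.single x 1) (block_del x us) - prepend u (block_htp x us)
      else 0)"

lemma lext_block_del_prepend:
  "lext (block_del x) (prepend u p) =
     (if Poly_Mapping.lookup u x = 0 then - prepend u (lext (block_del x) p)
      else if u = Poly_Mapping.single x 1 then p else 0)"
  by (simp add: lext_prepend lext_fun_uminus prepend_lext)

lemma lext_block_htp_prepend:
  "lext (block_htp x) (prepend u p) =
     (if Poly_Mapping.lookup u x = 0
      then - prepend (u + Poly_Mapping.single x 1) (lext (block_del x) p)
        - prepend u (lext (block_htp x) p)
      else 0)"
  by (simp add: lext_prepend lext_fun_uminus lext_fun_diff prepend_lext)

text \<open>Disposes of the tail of a word whose first block holds the only x.\<close>

lemma block_absent:
  assumes "Poly_Mapping.lookup (sum_list us) x = 0"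
  shows "block_del x us = (0 :: _ \<Rightarrow>\<^sub>0 'k::field)" "block_htp x us = (0 :: _ \<Rightarrow>\<^sub>0 'k)"
  using assms by (induction us) (auto simp: lookup_add prepend_linear)

lemma keys_bidiff:
  assumes "z \<in> Poly_Mapping.keys (bidiff u :: _ \<Rightarrow>\<^sub>0 'k::field)"
  shows "fst z + snd z = u"
proof -
  have "Poly_Mapping.keys (bidiff u :: _ \<Rightarrow>\<^sub>0 'k) \<subseteq> {z. fst z + snd z = u}"
    unfolding bidiff_def
    by (intro keys_add_subset keys_diff_subset) (auto dest: keys_comult_monomial)
  with assms show ?thesis by blast
qed

lemma lookup_bidiff_eq_0:
  assumes "z \<in> Poly_Mapping.keys (bidiff u :: _ \<Rightarrow>\<^sub>0 'k::field)" "Poly_Mapping.lookup u x = 0"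
  shows "Poly_Mapping.lookup (fst z) x = 0" "Poly_Mapping.lookup (snd z) x = 0"
  using keys_bidiff [OF assms(1)] assms(2) by (auto simp: lookup_add)

lemma var_factor:
  assumes "Poly_Mapping.lookup u x = Suc 0"
  obtains u' where "u = u' + Poly_Mapping.single x 1" "Poly_Mapping.lookup u' x = 0"
proof
  show "u = (u - Poly_Mapping.single x 1) + Poly_Mapping.single x 1"
    using assms by (auto intro!: poly_mapping_eqI simp: lookup_add lookup_minus lookup_single when_def)
  show "Poly_Mapping.lookup (u - Poly_Mapping.single x 1) x = 0"
    using assms by (simp add: lookup_minus)
qed

text \<open>Both factors of each term of \<open>bidiff u\<close> are free of x, so the deletion
  passes two blocks and the signs cancel.\<close>

lemma lext_block_del_bidiff:
  assumes "Poly_Mapping.lookup u x = 0"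
  shows "lext (block_del x) (prepend2 (bidiff u) p) = prepend2 (bidiff u) (lext (block_del x) p)"
  unfolding prepend2_def lext_lext
  using assms by (intro lext_cong) (simp add: lext_block_del_prepend lookup_bidiff_eq_0 prepend_linear)

lemma block_del_cobar_diff:
  assumes "Poly_Mapping.lookup (sum_list us) x = 1"
  shows "lext (block_del x) (cobar_diff_basis us) =
    - cobar_diff (block_del x us :: _ \<Rightarrow>\<^sub>0 'k::field)"
  using assms
proof (induction us)
  case (Cons u us)
  let ?x = "Poly_Mapping.single x 1 :: monomial"
  show ?case
  proof (cases "Poly_Mapping.lookup u x = 0")
    case True
    with Cons.prems have "Poly_Mapping.lookup (sum_list us) x = 1"
      by (simp add: lookup_add)
    with True show ?thesis
      by (simp add: Cons.IH cobar_diff_basis_Cons lext_diff lext_block_del_bidiff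
          lext_block_del_prepend prepend_linear cobar_diff_prepend cobar_diff_linear)
  next
    case False
    with Cons.prems have u: "Poly_Mapping.lookup u x = Suc 0"
      by (simp add: lookup_add)
    obtain v where v: "u = v + ?x" "Poly_Mapping.lookup v x = 0"
      using var_factor [OF u] .
    let ?P = "lext (block_del x) :: _ \<Rightarrow> _ \<Rightarrow>\<^sub>0 'k"
    \<comment> \<open>A left factor w x survives the deletion only if w = 1; the left counit law
      then leaves v.\<close>
    have "?P (prepend2 (lext (\<lambda>z. basis_vec (fst z + ?x, snd z)) (comult_monomial v)) (basis_vec us))
        = lext (\<lambda>z. if fst z = 0 then basis_vec (snd z # us) else 0) (comult_monomial v)"
      unfolding prepend2_lext lext_lext
      by (intro lext_cong) (simp add: lext_block_del_prepend lookup_add)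
    then have 1: "?P (prepend2 (lext (\<lambda>z. basis_vec (fst z + ?x, snd z)) (comult_monomial v)) (basis_vec us))
        = basis_vec (v # us)"
      by (simp only: comult_counit_left [where f = "\<lambda>w. basis_vec (w # us)"])
    \<comment> \<open>Now x lies in the second block, at the price of one sign, and must fill that
      block. The right counit law gives the opposite of the previous value.\<close>
    have "?P (prepend2 (lext (\<lambda>z. basis_vec (fst z, snd z + ?x)) (comult_monomial v)) (basis_vec us))
        = lext (\<lambda>z. if snd z = 0 then - basis_vec (fst z # us) else 0) (comult_monomial v)"
      unfolding prepend2_lext lext_lext
    proof (intro lext_cong)
      fix z assume "z \<in> Poly_Mapping.keys (comult_monomial v :: _ \<Rightarrow>\<^sub>0 'k)"
      from keys_comult_monomial [OF this] v(2) have "Poly_Mapping.lookup (fst z) x = 0"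
        by (auto simp: lookup_add)
      then show "?P (prepend2 (basis_vec (fst z, snd z + ?x)) (basis_vec us)) =
          (if snd z = 0 then - basis_vec (fst z # us) else 0)"
        by (simp add: lext_block_del_prepend lookup_add prepend_linear)
    qed
    then have 2: "?P (prepend2 (lext (\<lambda>z. basis_vec (fst z, snd z + ?x)) (comult_monomial v)) (basis_vec us))
        = - basis_vec (v # us)"
      by (simp only: comult_counit_right [where f = "\<lambda>w. - basis_vec (w # us)"])
    have bidiff: "bidiff u = basis_vec (0, u) -
        (lext (\<lambda>z. basis_vec (fst z + ?x, snd z)) (comult_monomial v) +
         lext (\<lambda>z. basis_vec (fst z, snd z + ?x)) (comult_monomial v)) + (basis_vec (u, 0) :: _ \<Rightarrow>\<^sub>0 'k)"
      unfolding bidiff_def v(1) comult_monomial_add_var ..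
    \<comment> \<open>The two halves of the coproduct cancel by 1 and 2. The terms 1 \<otimes> u and
      u \<otimes> 1 cancel each other if u = x and are killed otherwise.\<close>
    have "?P (prepend2 (bidiff u) (basis_vec us)) = 0"
      unfolding bidiff prepend2_linear lext_diff linear_extension_add 1 2
      using u by (simp add: lext_block_del_prepend prepend_linear del: prepend_basis_vec)
    then show ?thesis
      using u by (simp add: cobar_diff_basis_Cons lext_diff lext_block_del_prepend cobar_diff_def)
  qed
qed simp

lemma lext_block_htp_bidiff:
  assumes "Poly_Mapping.lookup u x = 0"
  shows "lext (block_htp x) (prepend2 (bidiff u) p :: _ \<Rightarrow>\<^sub>0 'k::field) =
    prepend2 (bidiff (u + Poly_Mapping.single x 1)) (lext (block_del x) p)
    + prepend (Poly_Mapping.single x 1) (prepend u (lext (block_del x) p))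
    + prepend u (prepend (Poly_Mapping.single x 1) (lext (block_del x) p))
    + prepend2 (bidiff u) (lext (block_htp x) p)"
proof -
  let ?x = "Poly_Mapping.single x 1 :: monomial"
  let ?P = "lext (block_del x) p"
  \<comment> \<open>Multiplication by x \<otimes> 1 + 1 \<otimes> x. It sends \<Delta> u to \<Delta>
    (u x); on the unit terms it also creates the two summands in which x forms a block of its
    own.\<close>
  define shift :: "(monomial \<times> monomial \<Rightarrow>\<^sub>0 'k) \<Rightarrow> _" where
    "shift q = lext (\<lambda>z. basis_vec (fst z + ?x, snd z)) q
      + lext (\<lambda>z. basis_vec (fst z, snd z + ?x)) q" for q
  have "lext (block_htp x) (prepend2 (bidiff u) p) =
      lext (\<lambda>z. prepend (fst z + ?x) (prepend (snd z) ?P) + prepend (fst z) (prepend (snd z + ?x) ?P)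
        + prepend (fst z) (prepend (snd z) (lext (block_htp x) p))) (bidiff u)"
    unfolding prepend2_def lext_lext using assms
    by (intro lext_cong)
      (simp add: lext_block_htp_prepend lext_block_del_prepend lookup_bidiff_eq_0 prepend_linear)
  also have "\<dots> = prepend2 (shift (bidiff u)) ?P + prepend2 (bidiff u) (lext (block_htp x) p)"
    by (simp add: lext_fun_add shift_def prepend2_linear prepend2_lext)
      (simp add: prepend2_def)
  also have "shift (bidiff u) = bidiff (u + ?x) + basis_vec (?x, u) + basis_vec (u, ?x)"
    unfolding bidiff_def comult_monomial_add_var
    by (simp add: shift_def linear_extension_add lext_diff del: One_nat_def)
  finally show ?thesis
    by (simp add: prepend2_linear del: One_nat_def)
qed

text \<open>If the first block u misses x, the terms with \<open>bidiff\<close> cancel between the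
  two composites; of the two extra summands, u \<otimes> x \<otimes> P cancels against the induction
  hypothesis and x \<otimes> u \<otimes> P is - x \<otimes> P of the longer word. If u contains x,
  \<open>block_htp\<close> vanishes on the word and everything comes from
  \<open>bidiff u\<close>.\<close>

lemma block_htp_cobar_diff:
  assumes "Poly_Mapping.lookup (sum_list us) x = 1"
  shows "cobar_diff (block_htp x us) + lext (block_htp x) (cobar_diff_basis us) =
    basis_vec us - prepend (Poly_Mapping.single x 1) (block_del x us :: _ \<Rightarrow>\<^sub>0 'k::field)"
  using assms
proof (induction us)
  case (Cons u us)
  let ?x = "Poly_Mapping.single x 1 :: monomial"
  show ?case
  proof (cases "Poly_Mapping.lookup u x = 0")
    case True
    with Cons.prems have us: "Poly_Mapping.lookup (sum_list us) x = 1"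
      by (simp add: lookup_add)
    have IH: "prepend u (cobar_diff (block_htp x us)) =
        prepend u (- lext (block_htp x) (cobar_diff_basis us) +
          basis_vec us - prepend ?x (block_del x us :: _ \<Rightarrow>\<^sub>0 'k))"
      using Cons.IH [OF us] by (intro arg_cong [where f = "prepend u"]) (simp add: algebra_simps)
    show ?thesis
      using True us
      by (simp add: IH cobar_diff_linear cobar_diff_basis_Cons cobar_diff_prepend lext_diff lext_block_htp_bidiff
          lext_block_htp_prepend block_del_cobar_diff prepend_linear del: One_nat_def)
  next
    case False
    with Cons.prems have u: "Poly_Mapping.lookup u x = Suc 0"
      and us: "Poly_Mapping.lookup (sum_list us) x = 0"
      by (simp_all add: lookup_add)
    obtain v where v: "u = v + ?x" "Poly_Mapping.lookup v x = 0"
      using var_factor [OF u] .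
    let ?H = "lext (block_htp x) :: _ \<Rightarrow> _ \<Rightarrow>\<^sub>0 'k"
    note simps = lext_block_htp_prepend lext_block_del_prepend lookup_add prepend_linear
      block_absent [OF us]
    have 1: "?H (prepend2 (lext (\<lambda>z. basis_vec (fst z + ?x, snd z)) (comult_monomial v)) (basis_vec us))
        = 0"
      unfolding prepend2_lext lext_lext
      by (intro lext_eq_0) (simp add: simps)
    have "?H (prepend2 (lext (\<lambda>z. basis_vec (fst z, snd z + ?x)) (comult_monomial v)) (basis_vec us))
        = lext (\<lambda>z. if snd z = 0 then - basis_vec ((fst z + ?x) # us) else 0) (comult_monomial v)"
      unfolding prepend2_lext lext_lext
    proof (intro lext_cong)
      fix z assume "z \<in> Poly_Mapping.keys (comult_monomial v :: _ \<Rightarrow>\<^sub>0 'k)"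
      from keys_comult_monomial [OF this] v(2) have "Poly_Mapping.lookup (fst z) x = 0"
        by (auto simp: lookup_add)
      then show "?H (prepend2 (basis_vec (fst z, snd z + ?x)) (basis_vec us)) =
          (if snd z = 0 then - basis_vec ((fst z + ?x) # us) else 0)"
        by (simp add: simps del: prepend_basis_vec) (simp add: simps)
    qed
    then have 2: "?H (prepend2 (lext (\<lambda>z. basis_vec (fst z, snd z + ?x)) (comult_monomial v)) (basis_vec us))
        = - basis_vec (u # us)"
      by (simp only: comult_counit_right [where f = "\<lambda>w. - basis_vec ((w + ?x) # us)"] v(1))
    have bidiff: "bidiff u = basis_vec (0, u) -
        (lext (\<lambda>z. basis_vec (fst z + ?x, snd z)) (comult_monomial v) +
         lext (\<lambda>z. basis_vec (fst z, snd z + ?x)) (comult_monomial v)) + (basis_vec (u, 0) :: _ \<Rightarrow>\<^sub>0 'k)"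
      unfolding bidiff_def v(1) comult_monomial_add_var ..
    \<comment> \<open>The half of the coproduct with x on the right gives back the word. In 1
      \<otimes> u the variable x can move only into the unit and only if u = x, which gives the
      subtracted term. The remaining terms begin with a block containing x.\<close>
    have "?H (prepend2 (bidiff u) (basis_vec us)) = basis_vec (u # us) - prepend ?x (block_del x (u # us))"
      unfolding bidiff prepend2_linear lext_diff linear_extension_add 1 2
      using u by (simp add: simps del: prepend_basis_vec)
    then show ?thesis
      using u by (simp add: cobar_diff_basis_Cons lext_diff lext_block_htp_prepend cobar_diff_def)
  qed
qed simp


section \<open>Contracting all variables\<close>

abbreviation var_word :: "nat list \<Rightarrow> monomial list" where
  "var_word \<equiv> map (\<lambda>x. Poly_Mapping.single x 1)"

fun iterated_del :: "nat list \<Rightarrow> monomial list \<Rightarrow> monomial list \<Rightarrow>\<^sub>0 'k::field" where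
  "iterated_del [] us = basis_vec us"
| "iterated_del (x # xs) us = lext (iterated_del xs) (block_del x us)"

text \<open>
  The correction term is subtracted because \<open>block_del x\<close> and prepending \<open>x\<close> both anticommute
  with the differential.
\<close>

fun iterated_htp :: "nat list \<Rightarrow> monomial list \<Rightarrow> monomial list \<Rightarrow>\<^sub>0 'k::field" where
  "iterated_htp [] us = (if even (length us) \<and> us \<noteq> [] then basis_vec (tl us) else 0)"
| "iterated_htp (x # xs) us = block_htp x us -
     prepend (Poly_Mapping.single x 1) (lext (iterated_htp xs) (block_del x us))"

text \<open>The functional that detects the class in degree n: its value on the variables of
  \<open>xs\<close> in permuted order is the sign of the permutation. Taking the coefficient of the
  empty word discards words with leftover blocks.\<close>

definition word_coeff :: "nat list \<Rightarrow> (monomial list \<Rightarrow>\<^sub>0 'k::field) \<Rightarrow> 'k" where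
  "word_coeff xs p = Poly_Mapping.lookup (lext (iterated_del xs) p) []"

lemma lext_if_eq: "lext (\<lambda>w. if w = a then b else 0) q = scale (Poly_Mapping.lookup q a) b"
proof (induction q rule: poly_mapping_additive_induct)
  case (single x c)
  then show ?case by (auto simp: lookup_single)
qed (simp add: linear_extension_add lookup_add scale_add)

text \<open>Presents the projection as a linear extension, so that the homotopy identity can be
  checked word by word.\<close>

lemma scale_word_coeff:
  "scale (word_coeff xs p) q = lext (\<lambda>us. scale (word_coeff xs (basis_vec us)) q) p"
proof -
  have "scale (word_coeff xs p) q = lext (\<lambda>w. if w = [] then q else 0) (lext (iterated_del xs) p)"
    by (simp add: word_coeff_def lext_if_eq)
  also have "\<dots> = lext (\<lambda>us. lext (\<lambda>w. if w = [] then q else 0) (iterated_del xs us)) p"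
    by (simp add: lext_lext)
  finally show ?thesis by (simp add: word_coeff_def lext_if_eq)
qed

lemma word_coeff_linear:
  "word_coeff xs 0 = 0"
  "word_coeff xs (p + q) = word_coeff xs p + word_coeff xs q"
  "word_coeff xs (p - q) = word_coeff xs p - word_coeff xs q"
  "word_coeff xs (- p) = - word_coeff xs p"
  "word_coeff xs (scale c p) = c * word_coeff xs p"
  "word_coeff xs (\<Sum>i\<in>I. r i) = (\<Sum>i\<in>I. word_coeff xs (r i))"
  by (simp_all add: word_coeff_def linear_extension_add lext_diff lext_uminus lext_scale lext_sum
      lookup_add lookup_minus lookup_sum)

lemma word_coeff_lext_eq_0:
  assumes "\<And>x. x \<in> Poly_Mapping.keys p \<Longrightarrow> word_coeff xs (f x) = 0"
  shows "word_coeff xs (lext f p) = 0"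
  using assms by (simp add: linear_extension_def word_coeff_linear)

lemma word_coeff_eq_0:
  fixes p :: "monomial list \<Rightarrow>\<^sub>0 'k::field"
  assumes "\<And>us. us \<in> Poly_Mapping.keys p \<Longrightarrow> word_coeff xs (basis_vec us) = (0 :: 'k)"
  shows "word_coeff xs p = 0"
  using word_coeff_lext_eq_0 [of p xs basis_vec, OF assms] by simp

lemma word_coeff_Cons: "word_coeff (x # xs) p = word_coeff xs (lext (block_del x) p)"
  by (simp add: word_coeff_def lext_lext iterated_del.simps(2) [abs_def])

section \<open>Effect of the operators on length and multidegree\<close>

lemma keys_prepend_subset:
  "Poly_Mapping.keys p \<subseteq> {w. u # w \<in> A} \<Longrightarrow> Poly_Mapping.keys (prepend u p) \<subseteq> A"
  unfolding prepend_def by (intro keys_lext_subset) auto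

lemma keys_block_del:
  assumes "w \<in> Poly_Mapping.keys (block_del x us :: _ \<Rightarrow>\<^sub>0 'k::field)"
  shows "Suc (length w) = length us \<and> Poly_Mapping.single x 1 + sum_list w = sum_list us"
proof -
  have "Poly_Mapping.keys (block_del x us :: _ \<Rightarrow>\<^sub>0 'k) \<subseteq>
      {w. Suc (length w) = length us \<and> Poly_Mapping.single x 1 + sum_list w = sum_list us}"
    (is "_ \<subseteq> ?A us")
  proof (induction us)
    case (Cons u us)
    have "Poly_Mapping.keys (prepend u (block_del x us :: _ \<Rightarrow>\<^sub>0 'k)) \<subseteq> ?A (u # us)"
      using Cons by (intro keys_prepend_subset) (auto simp: ac_simps)
    then show ?case by (simp add: keys_uminus)
  qed simp
  with assms show ?thesis by blast
qed

lemma keys_block_htp: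
  assumes "w \<in> Poly_Mapping.keys (block_htp x us :: _ \<Rightarrow>\<^sub>0 'k::field)"
  shows "Suc (length w) = length us \<and> sum_list w = sum_list us"
proof -
  have "Poly_Mapping.keys (block_htp x us :: _ \<Rightarrow>\<^sub>0 'k) \<subseteq>
      {w. Suc (length w) = length us \<and> sum_list w = sum_list us}" (is "_ \<subseteq> ?A us")
  proof (induction us)
    case (Cons u us)
    let ?u = "u + Poly_Mapping.single x 1"
    have "Poly_Mapping.keys (prepend ?u (block_del x us :: _ \<Rightarrow>\<^sub>0 'k)) \<subseteq> ?A (u # us)"
      by (intro keys_prepend_subset) (auto dest!: keys_block_del simp: ac_simps)
    moreover have "Poly_Mapping.keys (prepend u (block_htp x us :: _ \<Rightarrow>\<^sub>0 'k)) \<subseteq> ?A (u # us)"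
      using Cons by (intro keys_prepend_subset) auto
    ultimately show ?case
      using keys_diff_subset [of "- prepend ?u (block_del x us :: _ \<Rightarrow>\<^sub>0 'k)" "?A (u # us)"
          "prepend u (block_htp x us)"]
      by (simp add: keys_uminus)
  qed simp
  with assms show ?thesis by blast
qed

lemma monomial_add_eq_0_iff: "u + v = 0 \<longleftrightarrow> u = 0 \<and> v = (0 :: monomial)"
  by (auto simp: poly_mapping_eq_iff fun_eq_iff lookup_add)

text \<open>The multidegree claim is conditional because the base case drops the first block, which
  is harmless only when all remaining blocks are units.\<close>

lemma keys_iterated_htp:
  assumes "w \<in> Poly_Mapping.keys (iterated_htp xs us :: _ \<Rightarrow>\<^sub>0 'k::field)"
  shows "Suc (length w) = length us \<and> (sum_list us = sum_list (var_word xs) \<longrightarrow> sum_list w = sum_list us)"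
  using assms
proof (induction xs arbitrary: us w)
  case Nil
  then show ?case by (cases us) (auto simp: monomial_add_eq_0_iff split: if_splits)
next
  case (Cons x xs)
  let ?x = "Poly_Mapping.single x 1 :: monomial"
  let ?q = "lext (iterated_htp xs) (block_del x us) :: _ \<Rightarrow>\<^sub>0 'k"
  let ?A = "{w. Suc (length w) = length us \<and>
      (sum_list us = sum_list (var_word (x # xs)) \<longrightarrow> sum_list w = sum_list us)}"
  have "Poly_Mapping.keys ?q \<subseteq> {w. ?x # w \<in> ?A}"
  proof (rule keys_lext_subset, rule subsetI)
    fix v w assume "v \<in> Poly_Mapping.keys (block_del x us :: _ \<Rightarrow>\<^sub>0 'k)"
      and "w \<in> Poly_Mapping.keys (iterated_htp xs v :: _ \<Rightarrow>\<^sub>0 'k)"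
    from keys_block_del [OF this(1)] Cons.IH [OF this(2)]
    show "w \<in> {w. ?x # w \<in> ?A}" by auto
  qed
  then have "Poly_Mapping.keys (prepend ?x ?q) \<subseteq> ?A"
    by (rule keys_prepend_subset)
  moreover have "Poly_Mapping.keys (block_htp x us :: _ \<Rightarrow>\<^sub>0 'k) \<subseteq> ?A"
    using keys_block_htp [of _ x us] by blast
  ultimately show ?case
    using keys_diff_subset [of "block_htp x us :: _ \<Rightarrow>\<^sub>0 'k" ?A "prepend ?x ?q"] Cons.prems by auto
qed

lemma keys_cobar_diff_basis:
  assumes "w \<in> Poly_Mapping.keys (cobar_diff_basis us :: _ \<Rightarrow>\<^sub>0 'k::field)"
  shows "length w = Suc (length us) \<and> sum_list w = sum_list us"
proof -
  have "Poly_Mapping.keys (cobar_diff_basis us :: _ \<Rightarrow>\<^sub>0 'k) \<subseteq>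
      {w. length w = Suc (length us) \<and> sum_list w = sum_list us}" (is "_ \<subseteq> ?A us")
  proof (induction us)
    case Nil
    then show ?case by (simp add: cobar_diff_basis_Nil)
  next
    case (Cons u us)
    have "Poly_Mapping.keys (prepend u (cobar_diff_basis us :: _ \<Rightarrow>\<^sub>0 'k)) \<subseteq> ?A (u # us)"
      using Cons by (intro keys_prepend_subset) auto
    moreover have "Poly_Mapping.keys (prepend2 (bidiff u) (basis_vec us) :: _ \<Rightarrow>\<^sub>0 'k) \<subseteq> ?A (u # us)"
      unfolding prepend2_def
      by (intro keys_lext_subset) (auto dest!: keys_bidiff simp flip: add.assoc)
    ultimately show ?case
      unfolding cobar_diff_basis_Cons by (intro keys_diff_subset)
  qed
  with assms show ?thesis by blast
qed

text \<open>Each deletion shortens a word by one block, so only words as long as \<open>xs\<close>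
  can reach the empty word. This is what confines the cohomology to degree n.\<close>

lemma word_coeff_length:
  assumes "length us \<noteq> length xs"
  shows "word_coeff xs (basis_vec us) = (0 :: 'k::field)"
  using assms
proof (induction xs arbitrary: us)
  case Nil
  then show ?case by (simp add: word_coeff_def lookup_single)
next
  case (Cons x xs)
  have "word_coeff xs (block_del x us) = (0 :: 'k)"
  proof (rule word_coeff_eq_0)
    fix w assume "w \<in> Poly_Mapping.keys (block_del x us :: _ \<Rightarrow>\<^sub>0 'k)"
    from keys_block_del [OF this] Cons show "word_coeff xs (basis_vec w) = (0 :: 'k)" by simp
  qed
  then show ?case by (simp add: word_coeff_Cons)
qed

lemma word_coeff_var_word: "word_coeff xs (basis_vec (var_word xs)) = 1"
  by (induction xs) (simp_all add: word_coeff_Cons, simp add: word_coeff_def)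

lemma lookup_var_word:
  "x \<notin> set xs \<Longrightarrow> Poly_Mapping.lookup (sum_list (var_word xs)) x = 0"
  by (induction xs) (auto simp: lookup_add lookup_single)

lemma lookup_distinct_Cons:
  assumes "distinct (x # xs)" "sum_list us = sum_list (var_word (x # xs))"
  shows "Poly_Mapping.lookup (sum_list us) x = 1"
  using assms by (simp add: lookup_add lookup_var_word del: One_nat_def)

section \<open>The homotopy identity for a fixed order of the variables\<close>

lemma bidiff_var: "bidiff (Poly_Mapping.single x 1) = (0 :: _ \<Rightarrow>\<^sub>0 'k::field)"
  using comult_monomial_add_var [of 0 x, where ?'k = 'k]
  by (simp add: bidiff_def comult_monomial_0)

lemma sum_list_eq_0_iff_replicate:
  "sum_list us = (0 :: monomial) \<longleftrightarrow> us = replicate (length us) 0"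
proof (induction us)
  case (Cons u us)
  then show ?case by (simp add: monomial_add_eq_0_iff)
qed simp

text \<open>Among words of units the differential matches each odd length with the next even one,
  and only the empty word is left over. This explains the parity condition in the base case of
  \<open>iterated_htp\<close>.\<close>

lemma cobar_diff_basis_replicate_0:
  "cobar_diff_basis (replicate m 0) = (if odd m then basis_vec (replicate (Suc m) 0) else 0)"
  by (induction m)
    (simp_all add: cobar_diff_basis_Nil cobar_diff_basis_Cons bidiff_def comult_monomial_0 prepend_linear)

text \<open>The deletions anticommute with the differential down to words of units, whose
  differential never involves the empty word.\<close>

lemma word_coeff_cobar_diff:
  assumes "distinct xs" "sum_list us = sum_list (var_word xs)"
  shows "word_coeff xs (cobar_diff_basis us) = (0 :: 'k::field)"
  using assms
proof (induction xs arbitrary: us)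
  case Nil
  then have "us = replicate (length us) 0"
    using sum_list_eq_0_iff_replicate [of us] by simp
  then show ?case
    using cobar_diff_basis_replicate_0 [of "length us", where ?'a = 'k]
    by (simp add: word_coeff_def lookup_single split: if_splits)
next
  case (Cons x xs)
  have "lext (block_del x) (cobar_diff_basis us) = - cobar_diff (block_del x us :: _ \<Rightarrow>\<^sub>0 'k)"
    using lookup_distinct_Cons [OF Cons.prems] by (rule block_del_cobar_diff)
  moreover have "word_coeff xs (cobar_diff (block_del x us)) = (0 :: 'k)"
    unfolding cobar_diff_def
  proof (rule word_coeff_lext_eq_0)
    fix w assume "w \<in> Poly_Mapping.keys (block_del x us :: _ \<Rightarrow>\<^sub>0 'k)"
    from keys_block_del [OF this] Cons.prems show "word_coeff xs (cobar_diff_basis w) = (0 :: 'k)"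
      by (intro Cons.IH) auto
  qed
  ultimately show ?case by (simp add: word_coeff_Cons word_coeff_linear)
qed

lemma iterated_htp_cobar_diff:
  assumes "distinct xs" "sum_list us = sum_list (var_word xs)"
  shows "cobar_diff (iterated_htp xs us) + lext (iterated_htp xs) (cobar_diff_basis us) =
    basis_vec us - scale (word_coeff xs (basis_vec us)) (basis_vec (var_word xs) :: _ \<Rightarrow>\<^sub>0 'k::field)"
  using assms
proof (induction xs arbitrary: us)
  case Nil
  then obtain m where us: "us = replicate m 0"
    using sum_list_eq_0_iff_replicate [of us] by auto
  show ?case
    unfolding us
    by (cases m) (auto simp: cobar_diff_def word_coeff_def cobar_diff_basis_Nil cobar_diff_basis_replicate_0 lookup_single
        simp flip: replicate_Suc)
next
  case (Cons x xs)
  let ?x = "Poly_Mapping.single x 1 :: monomial"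
  let ?K = "iterated_htp xs :: _ \<Rightarrow> _ \<Rightarrow>\<^sub>0 'k"
  let ?p = "block_del x us :: _ \<Rightarrow>\<^sub>0 'k"
  have x: "Poly_Mapping.lookup (sum_list us) x = 1"
    by (rule lookup_distinct_Cons [OF Cons.prems])
  have htp: "lext (iterated_htp (x # xs)) q = lext (block_htp x) q - prepend ?x (lext ?K (lext (block_del x) q))" for q
    by (simp add: lext_fun_diff lext_lext prepend_lext iterated_htp.simps(2) [abs_def])
  have "cobar_diff (lext ?K ?p) + lext ?K (cobar_diff ?p) =
      lext (\<lambda>w. cobar_diff (?K w) + lext ?K (cobar_diff_basis w)) ?p"
    by (simp add: cobar_diff_def lext_lext lext_fun_add)
  also have "\<dots> = lext (\<lambda>w. basis_vec w - scale (word_coeff xs (basis_vec w)) (basis_vec (var_word xs))) ?p"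
    using Cons.prems by (intro lext_cong Cons.IH) (auto dest: keys_block_del)
  also have "\<dots> = ?p - scale (word_coeff xs ?p) (basis_vec (var_word xs))"
    by (simp add: lext_fun_diff flip: scale_word_coeff)
  finally have IH: "prepend ?x (cobar_diff (lext ?K ?p)) + prepend ?x (lext ?K (cobar_diff ?p)) =
      prepend ?x ?p - scale (word_coeff xs ?p) (basis_vec (var_word (x # xs)))"
    by (simp add: prepend_linear flip: prepend_linear(2))
  \<comment> \<open>Prepending the primitive x anticommutes with the differential, and so does
    deleting it; hence the subtracted correction contributes + x \<otimes> (d K + K d) P. By
    \<open>IH\<close> its term x \<otimes> P cancels the defect of \<open>block_htp\<close>.\<close>
  have "cobar_diff (iterated_htp (x # xs) us) + lext (iterated_htp (x # xs)) (cobar_diff_basis us) =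
      (cobar_diff (block_htp x us) + lext (block_htp x) (cobar_diff_basis us)) +
      (prepend ?x (cobar_diff (lext ?K ?p)) + prepend ?x (lext ?K (cobar_diff ?p)))"
    unfolding htp iterated_htp.simps block_del_cobar_diff [OF x]
    by (simp add: cobar_diff_linear cobar_diff_prepend bidiff_var prepend2_def lext_uminus prepend_linear
        del: One_nat_def)
  also have "\<dots> = basis_vec us - scale (word_coeff xs ?p) (basis_vec (var_word (x # xs)))"
    unfolding IH block_htp_cobar_diff [OF x] by simp
  finally show ?case by (simp add: word_coeff_Cons del: iterated_htp.simps)
qed


section \<open>Permuting the variables\<close>

lemma lookup_rename_vars:
  assumes "bij \<sigma>"
  shows "Poly_Mapping.lookup (rename_vars \<sigma> u) j = Poly_Mapping.lookup u (inv' \<sigma> j)"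
proof -
  have "\<sigma> i = j \<longleftrightarrow> i = inv' \<sigma> j" for i
    using assms by (metis bij_inv_eq_iff)
  then show ?thesis
    by (simp add: rename_vars_def lookup_sum lookup_single when_def in_keys_iff)
qed

lemma rename_vars_add:
  "bij \<sigma> \<Longrightarrow> rename_vars \<sigma> (u + v) = rename_vars \<sigma> u + rename_vars \<sigma> v"
  by (intro poly_mapping_eqI) (simp add: lookup_rename_vars lookup_add)

lemma rename_vars_0 [simp]: "rename_vars \<sigma> 0 = 0"
  by (simp add: rename_vars_def)

lemma rename_vars_single [simp]:
  "rename_vars \<sigma> (Poly_Mapping.single i c) = Poly_Mapping.single (\<sigma> i) c"
  by (simp add: rename_vars_def)

lemma rename_vars_id [simp]: "rename_vars id = id"
  by (intro ext poly_mapping_eqI) (simp add: lookup_rename_vars)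

lemma rename_vars_comp:
  "bij \<sigma> \<Longrightarrow> bij \<tau> \<Longrightarrow> rename_vars (\<sigma> \<circ> \<tau>) = rename_vars \<sigma> \<circ> rename_vars \<tau>"
  by (intro ext poly_mapping_eqI) (simp add: lookup_rename_vars bij_comp o_inv_distrib)

lemma rename_vars_eq_iff: "bij \<sigma> \<Longrightarrow> rename_vars \<sigma> u = rename_vars \<sigma> v \<longleftrightarrow> u = v"
  by (metis bij_imp_bij_inv bij_is_inj inv_o_cancel rename_vars_comp rename_vars_id id_apply comp_apply)

lemma sum_list_map_rename_vars:
  "bij \<sigma> \<Longrightarrow> sum_list (map (rename_vars \<sigma>) us) = rename_vars \<sigma> (sum_list us)"
  by (induction us) (simp_all add: rename_vars_add)

lemma cobar_act_basis_vec [simp]: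
  "cobar_act \<sigma> (basis_vec us) = basis_vec (map (rename_vars \<sigma>) us)"
  by (simp add: cobar_act_def)

lemma cobar_act_linear:
  "cobar_act \<sigma> 0 = 0"
  "cobar_act \<sigma> (p + q) = cobar_act \<sigma> p + cobar_act \<sigma> q"
  "cobar_act \<sigma> (p - q) = cobar_act \<sigma> p - cobar_act \<sigma> q"
  "cobar_act \<sigma> (- p) = - cobar_act \<sigma> p"
  "cobar_act \<sigma> (scale c p) = scale c (cobar_act \<sigma> p)"
  "cobar_act \<sigma> (\<Sum>i\<in>I. r i) = (\<Sum>i\<in>I. cobar_act \<sigma> (r i))"
  by (simp_all add: cobar_act_def linear_extension_add lext_diff lext_uminus lext_scale lext_sum)

lemma cobar_act_id [simp]: "cobar_act id p = p"
  by (simp add: cobar_act_def)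

lemma cobar_act_comp:
  "bij \<sigma> \<Longrightarrow> bij \<tau> \<Longrightarrow> cobar_act (\<sigma> \<circ> \<tau>) p = cobar_act \<sigma> (cobar_act \<tau> p)"
  by (simp add: cobar_act_def lext_lext rename_vars_comp)

lemma cobar_act_lext: "cobar_act \<sigma> (lext f p) = lext (\<lambda>x. cobar_act \<sigma> (f x)) p"
  by (simp add: cobar_act_def lext_lext)

lemma lext_cobar_act: "lext f (cobar_act \<sigma> p) = lext (\<lambda>us. f (map (rename_vars \<sigma>) us)) p"
  by (simp add: cobar_act_def lext_lext)

lemma cobar_act_prepend:
  "cobar_act \<sigma> (prepend u p) = prepend (rename_vars \<sigma> u) (cobar_act \<sigma> p)"
  by (simp add: cobar_act_def lext_prepend prepend_lext)

text \<open>Renaming permutes the primitive generators, hence respects the coproduct; this makes the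
  action commute with the differential.\<close>

lemma comult_monomial_rename_vars:
  assumes "bij \<sigma>"
  shows "comult_monomial (rename_vars \<sigma> u) =
    (lext (\<lambda>z. basis_vec (rename_vars \<sigma> (fst z), rename_vars \<sigma> (snd z))) (comult_monomial u)
      :: _ \<Rightarrow>\<^sub>0 'k::field)"
proof (induction u rule: monomial_induct)
  case (add u i)
  show ?case
    unfolding comult_monomial_add_var rename_vars_add [OF assms] rename_vars_single
      linear_extension_add add lext_lext
    by (simp add: rename_vars_add [OF assms])
qed (simp add: comult_monomial_0)

lemma bidiff_rename_vars:
  "bij \<sigma> \<Longrightarrow> bidiff (rename_vars \<sigma> u) =
    lext (\<lambda>z. basis_vec (rename_vars \<sigma> (fst z), rename_vars \<sigma> (snd z))) (bidiff u)"
  by (simp add: bidiff_def comult_monomial_rename_vars linear_extension_add lext_diff)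

lemma cobar_diff_basis_rename_vars:
  "bij \<sigma> \<Longrightarrow> cobar_diff_basis (map (rename_vars \<sigma>) us) = cobar_act \<sigma> (cobar_diff_basis us)"
proof (induction us)
  case (Cons u us)
  then have "prepend2 (bidiff (rename_vars \<sigma> u)) (basis_vec (map (rename_vars \<sigma>) us)) =
      cobar_act \<sigma> (prepend2 (bidiff u) (basis_vec us))"
    by (simp add: bidiff_rename_vars prepend2_lext)
      (simp add: prepend2_def cobar_act_lext)
  with Cons show ?case
    by (simp add: cobar_diff_basis_Cons cobar_act_linear cobar_act_prepend)
qed (simp add: cobar_diff_basis_Nil cobar_act_linear)

lemma cobar_diff_cobar_act:
  "bij \<sigma> \<Longrightarrow> cobar_diff (cobar_act \<sigma> p) = cobar_act \<sigma> (cobar_diff p)"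
  by (simp add: cobar_diff_def lext_cobar_act cobar_act_lext cobar_diff_basis_rename_vars)

lemma block_del_rename_vars:
  assumes "bij \<sigma>"
  shows "block_del (\<sigma> x) (map (rename_vars \<sigma>) us) = cobar_act \<sigma> (block_del x us)"
proof (induction us)
  case (Cons u us)
  have "rename_vars \<sigma> u = Poly_Mapping.single (\<sigma> x) 1 \<longleftrightarrow> u = Poly_Mapping.single x 1"
    using rename_vars_eq_iff [OF assms, of u "Poly_Mapping.single x 1"] by simp
  moreover have "Poly_Mapping.lookup (rename_vars \<sigma> u) (\<sigma> x) = Poly_Mapping.lookup u x"
    using assms by (simp add: lookup_rename_vars bij_is_inj)
  ultimately show ?case
    by (simp add: Cons cobar_act_linear cobar_act_prepend)
qed (simp add: cobar_act_linear)

lemma iterated_del_rename_vars: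
  assumes "bij \<sigma>"
  shows "iterated_del (map \<sigma> xs) (map (rename_vars \<sigma>) us) = cobar_act \<sigma> (iterated_del xs us)"
proof (induction xs arbitrary: us)
  case (Cons x xs)
  then show ?case
    by (simp add: block_del_rename_vars [OF assms] lext_cobar_act cobar_act_lext)
qed simp

lemma lookup_cobar_act_Nil: "Poly_Mapping.lookup (cobar_act \<sigma> p) [] = Poly_Mapping.lookup p []"
proof (induction p rule: poly_mapping_additive_induct)
  case (single us c)
  then show ?case
    by (cases us) (simp_all add: cobar_act_def scale_single lookup_single)
qed (simp add: cobar_act_linear lookup_add)

text \<open>Renaming turns the deletion of x into that of \<sigma> x and fixes the empty word.
  Acting on words thus amounts to reordering deletions, where the sign can be computed.\<close>

lemma word_coeff_rename_vars:
  "bij \<sigma> \<Longrightarrow> word_coeff (map \<sigma> xs) (cobar_act \<sigma> p) = word_coeff xs p"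
  by (simp add: word_coeff_def lext_cobar_act iterated_del_rename_vars
      flip: cobar_act_lext) (simp add: lookup_cobar_act_Nil)

text \<open>Removing the earlier block first lowers the position of the later one by one, which
  costs a sign; if x and y share a block, both sides vanish.\<close>

lemma block_del_anticommute:
  assumes "x \<noteq> y"
  shows "lext (block_del x) (block_del y us) = - lext (block_del y) (block_del x us)"
proof (induction us)
  case (Cons u us)
  then show ?case
    using assms by (simp add: lext_block_del_prepend lext_uminus prepend_linear lookup_single)
qed simp

lemma lext_iterated_del_Cons:
  "lext (iterated_del (x # xs)) p = lext (iterated_del xs) (lext (block_del x) p)"
  by (simp add: lext_lext iterated_del.simps(2) [abs_def])

lemma block_del_iterated_del:
  assumes "a \<notin> set xs"
  shows "lext (iterated_del xs) (block_del a us) =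
    (scale ((- 1) ^ length xs) (lext (block_del a) (iterated_del xs us)) :: _ \<Rightarrow>\<^sub>0 'k::field)"
  using assms
proof (induction xs arbitrary: us)
  case (Cons x xs)
  let ?D = "iterated_del xs :: _ \<Rightarrow> _ \<Rightarrow>\<^sub>0 'k"
  have "lext (iterated_del (x # xs)) (block_del a us) = lext ?D (lext (block_del x) (block_del a us))"
    by (rule lext_iterated_del_Cons)
  also have "\<dots> = - lext (\<lambda>w. lext ?D (block_del a w)) (block_del x us)"
    using Cons.prems by (simp add: block_del_anticommute [of x a] lext_uminus lext_lext)
  also have "\<dots> = - lext (\<lambda>w. scale ((- 1) ^ length xs) (lext (block_del a) (?D w))) (block_del x us)"
    using Cons by simp
  finally show ?case
    by (simp add: lext_iterated_del_Cons lext_fun_scale lext_lext scale_uminus)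
qed (simp add: iterated_del.simps(1) [abs_def])

lemma word_coeff_append: "word_coeff (xs @ ys) p = word_coeff ys (lext (iterated_del xs) p)"
proof (induction xs arbitrary: p)
  case (Cons x xs)
  then show ?case
    by (simp add: word_coeff_Cons lext_iterated_del_Cons lext_lext)
qed (simp add: iterated_del.simps(1) [abs_def])

lemma word_coeff_swap:
  assumes "distinct (as @ a # bs @ b # cs)"
  shows "word_coeff (as @ b # bs @ a # cs) p = - word_coeff (as @ a # bs @ b # cs) (p :: _ \<Rightarrow>\<^sub>0 'k::field)"
proof -
  \<comment> \<open>Moving the first deletion past \<open>bs\<close> costs the same sign for either
    order of a and b, so only the exchange of two adjacent deletions matters.\<close>
  have step: "lext (block_del d) (lext (iterated_del bs) (lext (block_del c) q)) =
      scale ((- 1) ^ length bs)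
        (lext (block_del d) (lext (block_del c) (lext (iterated_del bs) q)))"
    if "c \<notin> set bs" for c d and q :: "_ \<Rightarrow>\<^sub>0 'k"
    using that by (simp add: lext_lext block_del_iterated_del lext_scale lext_fun_scale)
  have anti: "lext (block_del a) (lext (block_del b) q) = - lext (block_del b) (lext (block_del a) q)"
    for q :: "_ \<Rightarrow>\<^sub>0 'k"
    using assms by (simp add: lext_lext block_del_anticommute [of a b] lext_fun_uminus)
  show ?thesis
    using assms
    by (simp add: word_coeff_append word_coeff_Cons step word_coeff_linear anti lext_uminus)
qed

lemma word_coeff_transpose:
  assumes "distinct xs" "a \<in> set xs" "b \<in> set xs" "a \<noteq> b"
  shows "word_coeff (map (Transposition.transpose a b) xs) p = - word_coeff xs p"
proof -
  have id: "map (Transposition.transpose a b) zs = zs" if "a \<notin> set zs" "b \<notin> set zs" for zs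
    using that by (induction zs) (auto simp: transpose_def)
  obtain us vs where xs: "xs = us @ a # vs" "a \<notin> set us" "a \<notin> set vs"
    using assms(1,2) by (metis distinct.simps(2) distinct_append in_set_conv_decomp_first
        not_distinct_conv_prefix split_list_first)
  show ?thesis
  proof (cases "b \<in> set us")
    case True
    then obtain us1 us2 where us: "us = us1 @ b # us2"
      by (meson split_list)
    have "distinct (us1 @ b # us2 @ a # vs)"
      using assms(1) by (simp add: xs us)
    from word_coeff_swap [OF this, of p] assms(1) show ?thesis
      by (simp add: xs us id)
  next
    case False
    with assms xs obtain vs1 vs2 where vs: "vs = vs1 @ b # vs2"
      by (metis in_set_conv_decomp set_ConsD Un_iff set_append)
    have "distinct (us @ a # vs1 @ b # vs2)"
      using assms(1) by (simp add: xs vs)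
    from word_coeff_swap [OF this, of p] assms(1) show ?thesis
      by (simp add: xs vs id)
  qed
qed

lemma word_coeff_map_permutes:
  assumes "\<sigma> permutes set xs" "distinct xs"
  shows "word_coeff (map \<sigma> xs) p = of_int (sign \<sigma>) * word_coeff xs p"
  using assms(1) finite_set
proof (induction rule: permutes_induct)
  case (swap a b \<sigma>)
  have "distinct (map \<sigma> xs)" "set (map \<sigma> xs) = set xs"
    using assms(2) swap.hyps by (simp_all add: distinct_map permutes_inj_on permutes_image)
  then have "word_coeff (map (Transposition.transpose a b) (map \<sigma> xs)) p = - word_coeff (map \<sigma> xs) p"
    using swap.hyps by (intro word_coeff_transpose) auto
  moreover have "sign (Transposition.transpose a b \<circ> \<sigma>) = - sign \<sigma>"
    using swap.hyps
    by (subst sign_compose) (auto simp: sign_swap_id permutation_swap_id intro: permutation_permutes [THEN iffD2])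
  ultimately show ?case
    using swap by (simp add: comp_def)
qed auto

text \<open>Renaming both the word and the list changes nothing; undoing the renaming of the list
  costs \<open>sign \<sigma>\<close>, which is its own inverse.\<close>

lemma word_coeff_cobar_act:
  assumes "\<sigma> permutes set xs" "distinct xs"
  shows "word_coeff xs (cobar_act \<sigma> p) = of_int (sign \<sigma>) * (word_coeff xs p :: 'k::field)"
proof -
  have "word_coeff xs p = of_int (sign \<sigma>) * word_coeff xs (cobar_act \<sigma> p)"
    using word_coeff_rename_vars [of \<sigma> xs p] word_coeff_map_permutes [OF assms, of "cobar_act \<sigma> p"]
      permutes_bij [OF assms(1)] by simp
  moreover have "of_int (sign \<sigma>) * of_int (sign \<sigma>) = (1 :: 'k)"
    by (simp flip: of_int_mult)
  ultimately show ?thesis by (simp flip: mult.assoc)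
qed


section \<open>Quotients of modules\<close>

lemma ring_of_type_algebra_simps [simp]:
  "carrier ring_of_type_algebra = UNIV"
  "x \<oplus>\<^bsub>ring_of_type_algebra\<^esub> y = x + y"
  "x \<otimes>\<^bsub>ring_of_type_algebra\<^esub> y = x * y"
  "\<one>\<^bsub>ring_of_type_algebra\<^esub> = 1"
  "\<zero>\<^bsub>ring_of_type_algebra\<^esub> = 0"
  by (simp_all add: ring_of_type_algebra_def)

lemma linear_maps_closed: "f \<in> linear_maps V W \<Longrightarrow> x \<in> carrier V \<Longrightarrow> f x \<in> carrier W"
  and linear_maps_add: "f \<in> linear_maps V W \<Longrightarrow> x \<in> carrier V \<Longrightarrow> y \<in> carrier V \<Longrightarrow>
    f (x \<oplus>\<^bsub>V\<^esub> y) = f x \<oplus>\<^bsub>W\<^esub> f y"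
  and linear_maps_smult: "f \<in> linear_maps V W \<Longrightarrow> x \<in> carrier V \<Longrightarrow>
    f (c \<odot>\<^bsub>V\<^esub> x) = c \<odot>\<^bsub>W\<^esub> f x"
  by (auto simp: linear_maps_def)

lemma linear_maps_zero:
  assumes "module ring_of_type_algebra V" "module ring_of_type_algebra W" "f \<in> linear_maps V W"
  shows "f \<zero>\<^bsub>V\<^esub> = \<zero>\<^bsub>W\<^esub>"
proof -
  interpret V: module ring_of_type_algebra V by fact
  interpret W: module ring_of_type_algebra W by fact
  have "f (0 \<odot>\<^bsub>V\<^esub> \<zero>\<^bsub>V\<^esub>) = 0 \<odot>\<^bsub>W\<^esub> f \<zero>\<^bsub>V\<^esub>"
    using assms by (intro linear_maps_smult) auto
  then show ?thesis
    using V.smult_l_null [of "\<zero>\<^bsub>V\<^esub>"] W.smult_l_null [of "f \<zero>\<^bsub>V\<^esub>"] assms(3)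
    by (simp add: linear_maps_closed)
qed

lemma (in module) subgroup_of_submodule:
  "submodule H R M \<Longrightarrow> subgroup H (add_monoid M)"
  by (rule submodule.axioms)

locale quotient_data = module ring_of_type_algebra V for V :: "('k::field, 'v) module" +
  fixes W :: "'v set"
  assumes submodule: "submodule W ring_of_type_algebra V"
begin

sublocale W: abelian_subgroup W V
  by (intro abelian_subgroupI3 additive_subgroupI subgroup_of_submodule submodule M.abelian_group_axioms)

lemma W_smult: "w \<in> W \<Longrightarrow> c \<odot>\<^bsub>V\<^esub> w \<in> W"
  using submodule.smult_closed [OF submodule] by simp

lemma coset_memE:
  assumes "y \<in> W +>\<^bsub>V\<^esub> x"
  obtains w where "w \<in> W" "y = w \<oplus>\<^bsub>V\<^esub> x"
  using assms by (auto simp: a_r_coset_def')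

lemma coset_eqI:
  assumes "w \<in> W" "x \<in> carrier V" "y = w \<oplus>\<^bsub>V\<^esub> x"
  shows "W +>\<^bsub>V\<^esub> y = W +>\<^bsub>V\<^esub> x"
proof -
  have "y \<in> W +>\<^bsub>V\<^esub> x" using assms by (auto simp: a_r_coset_def')
  then show ?thesis
    using assms(2) W.a_subgroup by (metis a_repr_independence)
qed

text \<open>Operations on the quotient are unions over representatives; independence of the
  representative collapses such a union to a single value.\<close>

lemma coset_Union:
  assumes x: "x \<in> carrier V" and eq: "\<And>w. w \<in> W \<Longrightarrow> F (w \<oplus>\<^bsub>V\<^esub> x) = F x"
  shows "(\<Union>y\<in>W +>\<^bsub>V\<^esub> x. F y) = F x"
proof -
  have "F y = F x" if "y \<in> W +>\<^bsub>V\<^esub> x" for y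
    using coset_memE [OF that] eq by metis
  moreover have "x \<in> W +>\<^bsub>V\<^esub> x" using x by (rule W.a_rcos_self)
  ultimately show ?thesis by blast
qed

lemma quotient_simps:
  "carrier (quotient_module V W) = {W +>\<^bsub>V\<^esub> x | x. x \<in> carrier V}"
  "\<zero>\<^bsub>quotient_module V W\<^esub> = W"
  "x \<in> carrier V \<Longrightarrow> y \<in> carrier V \<Longrightarrow>
    (W +>\<^bsub>V\<^esub> x) \<oplus>\<^bsub>quotient_module V W\<^esub> (W +>\<^bsub>V\<^esub> y) = W +>\<^bsub>V\<^esub> (x \<oplus>\<^bsub>V\<^esub> y)"
  "x \<in> carrier V \<Longrightarrow>
    c \<odot>\<^bsub>quotient_module V W\<^esub> (W +>\<^bsub>V\<^esub> x) = W +>\<^bsub>V\<^esub> (c \<odot>\<^bsub>V\<^esub> x)"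
proof -
  show "carrier (quotient_module V W) = {W +>\<^bsub>V\<^esub> x | x. x \<in> carrier V}"
    by (auto simp: quotient_module_def A_RCOSETS_def')
  show "\<zero>\<^bsub>quotient_module V W\<^esub> = W"
    by (simp add: quotient_module_def)
  show "x \<in> carrier V \<Longrightarrow> y \<in> carrier V \<Longrightarrow>
    (W +>\<^bsub>V\<^esub> x) \<oplus>\<^bsub>quotient_module V W\<^esub> (W +>\<^bsub>V\<^esub> y) = W +>\<^bsub>V\<^esub> (x \<oplus>\<^bsub>V\<^esub> y)"
    by (simp add: quotient_module_def W.a_rcos_sum)
  assume x: "x \<in> carrier V"
  have "W +>\<^bsub>V\<^esub> (c \<odot>\<^bsub>V\<^esub> (w \<oplus>\<^bsub>V\<^esub> x)) = W +>\<^bsub>V\<^esub> (c \<odot>\<^bsub>V\<^esub> x)" if "w \<in> W" for w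
    using x that W.a_Hcarr [OF that]
    by (intro coset_eqI [of "c \<odot>\<^bsub>V\<^esub> w"]) (simp_all add: W_smult smult_r_distr)
  then show "c \<odot>\<^bsub>quotient_module V W\<^esub> (W +>\<^bsub>V\<^esub> x) = W +>\<^bsub>V\<^esub> (c \<odot>\<^bsub>V\<^esub> x)"
    using x by (simp add: quotient_module_def coset_Union)
qed

lemma coset_eq_W: "x \<in> W \<Longrightarrow> W +>\<^bsub>V\<^esub> x = W"
  using W.a_Hcarr W.a_subgroup by (intro a_coset_join2)

lemma module_quotient: "module ring_of_type_algebra (quotient_module V W)"
proof (rule moduleI)
  have W: "W = W +>\<^bsub>V\<^esub> \<zero>\<^bsub>V\<^esub>"
    using coset_eq_W [of "\<zero>\<^bsub>V\<^esub>"] by simp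
  show "abelian_group (quotient_module V W)"
  proof (rule abelian_groupI)
    show "\<zero>\<^bsub>quotient_module V W\<^esub> \<in> carrier (quotient_module V W)"
      using W by (auto simp: quotient_simps)
  next
    fix Q assume "Q \<in> carrier (quotient_module V W)"
    then obtain x where x: "x \<in> carrier V" "Q = W +>\<^bsub>V\<^esub> x"
      by (auto simp: quotient_simps)
    show "\<zero>\<^bsub>quotient_module V W\<^esub> \<oplus>\<^bsub>quotient_module V W\<^esub> Q = Q"
      using quotient_simps(3) [of "\<zero>\<^bsub>V\<^esub>" x] x by (simp add: quotient_simps(2) flip: W)
    show "\<exists>P\<in>carrier (quotient_module V W).
        P \<oplus>\<^bsub>quotient_module V W\<^esub> Q = \<zero>\<^bsub>quotient_module V W\<^esub>"
      using quotient_simps(3) [of "\<ominus>\<^bsub>V\<^esub> x" x] x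
      by (intro bexI [of _ "W +>\<^bsub>V\<^esub> (\<ominus>\<^bsub>V\<^esub> x)"]) (auto simp: quotient_simps M.l_neg simp flip: W)
  qed (auto simp: quotient_simps M.add.m_ac)
qed (auto simp: quotient_simps smult_l_distr [simplified] smult_r_distr smult_assoc1 [simplified]
    smult_one [simplified] intro: R.is_cring)

end

text \<open>The first isomorphism theorem for a subquotient: \<Phi> lives on Z, is constant along W,
  and elements of Z with equal values differ by W.\<close>

lemma linearly_isomorphic_quotient:
  fixes N :: "('k::field, 'v) module" and T :: "('k, 't) module"
  assumes "module ring_of_type_algebra N" "submodule W ring_of_type_algebra N"
    and Z: "Z \<subseteq> carrier N" "\<And>x y. x \<in> Z \<Longrightarrow> y \<in> Z \<Longrightarrow> x \<oplus>\<^bsub>N\<^esub> y \<in> Z" "\<And>c x. x \<in> Z \<Longrightarrow> c \<odot>\<^bsub>N\<^esub> x \<in> Z"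
    and \<Phi>: "\<And>x y. x \<in> Z \<Longrightarrow> y \<in> Z \<Longrightarrow> \<Phi> (x \<oplus>\<^bsub>N\<^esub> y) = \<Phi> x \<oplus>\<^bsub>T\<^esub> \<Phi> y"
      "\<And>c x. x \<in> Z \<Longrightarrow> \<Phi> (c \<odot>\<^bsub>N\<^esub> x) = c \<odot>\<^bsub>T\<^esub> \<Phi> x"
      "\<And>w x. w \<in> W \<Longrightarrow> x \<in> Z \<Longrightarrow> \<Phi> (w \<oplus>\<^bsub>N\<^esub> x) = \<Phi> x"
      "\<Phi> ` Z = carrier T"
      "\<And>x y. x \<in> Z \<Longrightarrow> y \<in> Z \<Longrightarrow> \<Phi> x = \<Phi> y \<Longrightarrow> x \<ominus>\<^bsub>N\<^esub> y \<in> W"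
  shows "linearly_isomorphic (quotient_module (N\<lparr>carrier := Z\<rparr>) W) T"
proof -
  interpret quotient_data N W
    using assms by (simp add: quotient_data_def quotient_data_axioms_def)
  let ?Q = "quotient_module (N\<lparr>carrier := Z\<rparr>) W"
  \<comment> \<open>A coset depends only on the addition, so shrinking the carrier to Z changes
    none, and the operations can be read off in the quotient of N.\<close>
  have coset: "W +>\<^bsub>N\<lparr>carrier := Z\<rparr>\<^esub> x = W +>\<^bsub>N\<^esub> x" for x
    by (simp add: a_r_coset_def')
  have carrier: "carrier ?Q = {W +>\<^bsub>N\<^esub> x | x. x \<in> Z}"
    by (auto simp: quotient_module_def A_RCOSETS_def' coset)
  have add: "(W +>\<^bsub>N\<^esub> x) \<oplus>\<^bsub>?Q\<^esub> (W +>\<^bsub>N\<^esub> y) = W +>\<^bsub>N\<^esub> (x \<oplus>\<^bsub>N\<^esub> y)" if "x \<in> Z" "y \<in> Z" for x y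
    using quotient_simps(3) [of x y] that Z(1)
    by (auto simp: quotient_module_def set_add_def')
  have smult: "c \<odot>\<^bsub>?Q\<^esub> (W +>\<^bsub>N\<^esub> x) = W +>\<^bsub>N\<^esub> (c \<odot>\<^bsub>N\<^esub> x)" if "x \<in> Z" for c x
    using quotient_simps(4) [of x c] that Z(1)
    by (auto simp: quotient_module_def a_r_coset_def')
  define F where "F Q = (THE t. t \<in> \<Phi> ` Q)" for Q
  have F: "F (W +>\<^bsub>N\<^esub> x) = \<Phi> x" if "x \<in> Z" for x
    unfolding F_def
  proof (rule the_equality)
    show "\<Phi> x \<in> \<Phi> ` (W +>\<^bsub>N\<^esub> x)"
      using W.a_rcos_self Z(1) that by blast
    show "t = \<Phi> x" if "t \<in> \<Phi> ` (W +>\<^bsub>N\<^esub> x)" for t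
      using that \<Phi>(3) \<open>x \<in> Z\<close> by (auto elim!: coset_memE)
  qed
  have "F \<in> linear_maps ?Q T"
    unfolding linear_maps_def carrier
    using \<Phi> Z by (auto simp: F add smult)
  moreover have "bij_betw F (carrier ?Q) (carrier T)"
    unfolding bij_betw_def
  proof
    show "inj_on F (carrier ?Q)"
      unfolding carrier
    proof (rule inj_onI, clarify)
      fix x y assume xy: "x \<in> Z" "y \<in> Z" "F (W +>\<^bsub>N\<^esub> x) = F (W +>\<^bsub>N\<^esub> y)"
      then have "x \<ominus>\<^bsub>N\<^esub> y \<in> W" using \<Phi>(5) F by simp
      moreover have "x = (x \<ominus>\<^bsub>N\<^esub> y) \<oplus>\<^bsub>N\<^esub> y"
        using xy Z(1) by (auto simp: a_minus_def M.a_assoc M.l_neg subset_iff)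
      ultimately show "W +>\<^bsub>N\<^esub> x = W +>\<^bsub>N\<^esub> y"
        using xy Z(1) by (intro coset_eqI) auto
    qed
    show "F ` carrier ?Q = carrier T"
      unfolding carrier \<Phi>(4) [symmetric] using F by (auto simp: image_iff) metis
  qed
  ultimately show ?thesis
    unfolding linearly_isomorphic_def by blast
qed


section \<open>Tensor products over a group\<close>

lemma free_module_simps [simp]:
  "carrier (free_module B) = {p. Poly_Mapping.keys p \<subseteq> B}"
  "\<zero>\<^bsub>free_module B\<^esub> = 0"
  "p \<oplus>\<^bsub>free_module B\<^esub> q = p + q"
  "c \<odot>\<^bsub>free_module B\<^esub> p = scale c p"
  by (simp_all add: free_module_def)

lemma keys_scale_subset: "Poly_Mapping.keys p \<subseteq> A \<Longrightarrow> Poly_Mapping.keys (scale c p) \<subseteq> A"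
  using keys_scale by (rule order_trans)

lemma module_free_module:
  "module ring_of_type_algebra (free_module B :: ('k::field, 'b \<Rightarrow>\<^sub>0 'k) module)"
proof (rule moduleI)
  show "abelian_group (free_module B :: ('k, 'b \<Rightarrow>\<^sub>0 'k) module)"
  proof (rule abelian_groupI)
    show "\<exists>q\<in>carrier (free_module B). q \<oplus>\<^bsub>free_module B\<^esub> p = \<zero>\<^bsub>free_module B\<^esub>"
      if "p \<in> carrier (free_module B)" for p :: "'b \<Rightarrow>\<^sub>0 'k"
      using that by (intro bexI [of _ "- p"]) (auto simp: keys_uminus)
  qed (simp_all add: ac_simps keys_add_subset)
qed (simp_all add: scale_add scale_add_right scale_scale keys_scale_subset cring_from_type_algebra)

lemma submodule_free_module_iff:
  "submodule R ring_of_type_algebra (free_module B :: ('k::field, 'b \<Rightarrow>\<^sub>0 'k) module) \<longleftrightarrow>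
     R \<subseteq> {p. Poly_Mapping.keys p \<subseteq> B} \<and> 0 \<in> R \<and> (\<forall>p\<in>R. \<forall>q\<in>R. p + q \<in> R) \<and>
     (\<forall>c. \<forall>p\<in>R. scale c p \<in> R)"
proof -
  interpret module ring_of_type_algebra "free_module B :: ('k, 'b \<Rightarrow>\<^sub>0 'k) module"
    by (rule module_free_module)
  show ?thesis (is "?S \<longleftrightarrow> ?C")
  proof
    assume ?S
    from submoduleE [OF this] submodule.axioms(1) [OF this, THEN subgroup.one_closed] show ?C
      by auto
  next
    assume C: ?C
    show ?S
    proof (rule submoduleI)
      fix p assume p: "p \<in> R"
      with C have "Poly_Mapping.keys p \<subseteq> B" by blast
      then have "\<ominus>\<^bsub>free_module B\<^esub> p = - p"
        using M.minus_equality [of "- p" p] by (simp add: keys_uminus)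
      also have "\<dots> = scale (- 1) p" by (simp add: scale_minus_1)
      finally show "\<ominus>\<^bsub>free_module B\<^esub> p \<in> R" using C p by simp
    qed (use C in auto)
  qed
qed

lemma submodule_hull_free_module:
  assumes "S \<subseteq> {p. Poly_Mapping.keys p \<subseteq> B}"
  shows "submodule ((\<lambda>R. submodule R ring_of_type_algebra (free_module B)) hull S)
    ring_of_type_algebra (free_module B)"
proof -
  let ?s = "\<lambda>R. submodule R ring_of_type_algebra (free_module B)"
  \<comment> \<open>The hull is an intersection; it stays inside the carrier because the carrier is
    itself a submodule containing S.\<close>
  have "?s {p. Poly_Mapping.keys p \<subseteq> B}"
    unfolding submodule_free_module_iff
    by (simp add: keys_add_subset keys_scale_subset)
  with assms have "?s hull S \<subseteq> {p. Poly_Mapping.keys p \<subseteq> B}"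
    by (rule hull_minimal)
  then show ?thesis
    unfolding submodule_free_module_iff [of "_ hull _"]
    by (auto simp: hull_def) (auto simp: submodule_free_module_iff)
qed

locale tensor_pair = M: module ring_of_type_algebra M + V: module ring_of_type_algebra V
  for M :: "('k::field, 'm) module" and V :: "('k, 'v) module" +
  fixes G :: "'g set" and ract :: "'m \<Rightarrow> 'g \<Rightarrow> 'm" and lact :: "'g \<Rightarrow> 'v \<Rightarrow> 'v"
  assumes ract_closed: "x \<in> carrier M \<Longrightarrow> g \<in> G \<Longrightarrow> ract x g \<in> carrier M"
    and lact_closed: "v \<in> carrier V \<Longrightarrow> g \<in> G \<Longrightarrow> lact g v \<in> carrier V"
begin

abbreviation "relations \<equiv> tensor_relations G M ract V lact"

lemma tensor_relators_subset:
  "tensor_relators G M ract V lact \<subseteq> {p. Poly_Mapping.keys p \<subseteq> carrier M \<times> carrier V}"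
proof -
  define K where "K = {p :: 'm \<times> 'v \<Rightarrow>\<^sub>0 'k. Poly_Mapping.keys p \<subseteq> carrier M \<times> carrier V}"
  have "basis_vec (x, v) \<in> K" if "x \<in> carrier M" "v \<in> carrier V" for x v
    using that by (simp add: K_def)
  moreover have "p - q \<in> K" if "p \<in> K" "q \<in> K" for p q
    using that by (simp add: K_def keys_diff_subset)
  moreover have "scale c p \<in> K" if "p \<in> K" for c p
    using that by (simp add: K_def keys_scale_subset)
  ultimately have "tensor_relators G M ract V lact \<subseteq> K"
    using M.smult_closed V.smult_closed unfolding tensor_relators_def
    by (auto simp: ract_closed lact_closed)
  then show ?thesis by (simp add: K_def)
qed

lemma submodule_relations:
  "submodule relations ring_of_type_algebra (free_module (carrier M \<times> carrier V))"
  unfolding tensor_relations_def by (intro submodule_hull_free_module tensor_relators_subset)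

sublocale quotient_data "free_module (carrier M \<times> carrier V)" relations
  by (simp add: quotient_data_def quotient_data_axioms_def module_free_module submodule_relations)

end

lemma tensor_pairI:
  assumes "module ring_of_type_algebra M" "module ring_of_type_algebra V"
    "\<And>x g. x \<in> carrier M \<Longrightarrow> g \<in> G \<Longrightarrow> ract x g \<in> carrier M"
    "\<And>v g. v \<in> carrier V \<Longrightarrow> g \<in> G \<Longrightarrow> lact g v \<in> carrier V"
  shows "tensor_pair M V G ract lact"
  using assms by (simp add: tensor_pair_def tensor_pair_axioms_def)


context tensor_pair
begin

lemma relations_closed:
  "p \<in> relations \<Longrightarrow> q \<in> relations \<Longrightarrow> p + q \<in> relations"
  "p \<in> relations \<Longrightarrow> scale c p \<in> relations"
  "p \<in> relations \<Longrightarrow> Poly_Mapping.keys p \<subseteq> carrier M \<times> carrier V"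
  "0 \<in> relations"
  using submodule_relations unfolding submodule_free_module_iff by blast+

lemma relators_in_relations:
  "\<lbrakk>x \<in> carrier M; y \<in> carrier M; v \<in> carrier V\<rbrakk> \<Longrightarrow>
    basis_vec (x \<oplus>\<^bsub>M\<^esub> y, v) - basis_vec (x, v) - basis_vec (y, v) \<in> relations"
  "\<lbrakk>x \<in> carrier M; v \<in> carrier V; w \<in> carrier V\<rbrakk> \<Longrightarrow>
    basis_vec (x, v \<oplus>\<^bsub>V\<^esub> w) - basis_vec (x, v) - basis_vec (x, w) \<in> relations"
  "\<lbrakk>x \<in> carrier M; v \<in> carrier V\<rbrakk> \<Longrightarrow>
    basis_vec (c \<odot>\<^bsub>M\<^esub> x, v) - scale c (basis_vec (x, v)) \<in> relations"
  "\<lbrakk>x \<in> carrier M; v \<in> carrier V\<rbrakk> \<Longrightarrow>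
    basis_vec (x, c \<odot>\<^bsub>V\<^esub> v) - scale c (basis_vec (x, v)) \<in> relations"
  "\<lbrakk>x \<in> carrier M; g \<in> G; v \<in> carrier V\<rbrakk> \<Longrightarrow>
    basis_vec (ract x g, v) - basis_vec (x, lact g v) \<in> relations"
  unfolding tensor_relations_def
  by (rule hull_inc, simp only: tensor_relators_def, blast)+

lemma relations_minimal:
  assumes "tensor_relators G M ract V lact \<subseteq> R"
    and "submodule R ring_of_type_algebra (free_module (carrier M \<times> carrier V))"
  shows "relations \<subseteq> R"
  unfolding tensor_relations_def using assms by (rule hull_minimal)

lemma relations_coset_eqI:
  assumes "p - q \<in> relations" "Poly_Mapping.keys q \<subseteq> carrier M \<times> carrier V"
  shows "relations +>\<^bsub>free_module (carrier M \<times> carrier V)\<^esub> p =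
    relations +>\<^bsub>free_module (carrier M \<times> carrier V)\<^esub> q"
  using assms by (intro coset_eqI [of "p - q"]) simp_all

lemma lext_in_relations:
  fixes p :: "'c \<Rightarrow>\<^sub>0 'k"
  assumes "\<And>z. z \<in> Poly_Mapping.keys p \<Longrightarrow> f z \<in> relations"
  shows "lext f p \<in> relations"
proof -
  have "(\<Sum>i\<in>I. g i) \<in> relations" if "\<And>i. i \<in> I \<Longrightarrow> g i \<in> relations" for I and g :: "'c \<Rightarrow> _"
    using that by (induction I rule: infinite_finite_induct) (auto simp: relations_closed)
  then show ?thesis
    using assms by (simp add: linear_extension_def relations_closed)
qed

end

section \<open>Functoriality of the tensor product over a group\<close>

definition equivariant_maps ::
  "'g set \<Rightarrow> ('k::field, 'v) module \<Rightarrow> ('g \<Rightarrow> 'v \<Rightarrow> 'v) \<Rightarrow> ('k, 'w) module \<Rightarrow> ('g \<Rightarrow> 'w \<Rightarrow> 'w) \<Rightarrow>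
    ('v \<Rightarrow> 'w) set" where
  "equivariant_maps G V lactV W lactW =
     {f \<in> linear_maps V W. \<forall>g\<in>G. \<forall>v\<in>carrier V. f (lactV g v) = lactW g (f v)}"

abbreviation tensor_map :: "('v \<Rightarrow> 'w) \<Rightarrow> ('m \<times> 'v \<Rightarrow>\<^sub>0 'k::field) \<Rightarrow> 'm \<times> 'w \<Rightarrow>\<^sub>0 'k" where
  "tensor_map f \<equiv> lext (\<lambda>(x, v). basis_vec (x, f v))"

lemma keys_tensor_map:
  assumes "\<And>v. v \<in> B \<Longrightarrow> f v \<in> C" "Poly_Mapping.keys p \<subseteq> A \<times> B"
  shows "Poly_Mapping.keys (tensor_map f p) \<subseteq> A \<times> C"
  using assms by (intro keys_lext_subset) auto

locale tensor_morphism =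
  V: tensor_pair M V G ract lactV + W: tensor_pair M W G ract lactW
  for M :: "('k::field, 'm) module" and V :: "('k, 'v) module" and W :: "('k, 'w) module"
    and G :: "'g set" and ract lactV lactW +
  fixes f :: "'v \<Rightarrow> 'w"
  assumes equivariant: "f \<in> equivariant_maps G V lactV W lactW"
begin

abbreviation "tensored \<equiv> group_tensor_map G M ract W lactW f"

lemma f_linear: "f \<in> linear_maps V W"
  using equivariant by (simp add: equivariant_maps_def)

lemma f_closed: "v \<in> carrier V \<Longrightarrow> f v \<in> carrier W"
  by (rule linear_maps_closed [OF f_linear])

lemma tensor_map_closed:
  "Poly_Mapping.keys p \<subseteq> carrier M \<times> carrier V \<Longrightarrow>
    Poly_Mapping.keys (tensor_map f p) \<subseteq> carrier M \<times> carrier W"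
  by (rule keys_tensor_map [OF f_closed])

text \<open>The preimage of the target relations is a submodule, so generators suffice: linearity of
  \<open>f\<close> handles the bilinear relators and equivariance the balancing ones.\<close>

lemma tensor_map_relations:
  assumes "p \<in> V.relations"
  shows "tensor_map f p \<in> W.relations"
proof -
  let ?R = "{p. Poly_Mapping.keys p \<subseteq> carrier M \<times> carrier V \<and> tensor_map f p \<in> W.relations}"
  have "V.relations \<subseteq> ?R"
  proof (rule V.relations_minimal)
    have "tensor_map f p \<in> W.relations" if "p \<in> tensor_relators G M ract V lactV" for p
      using that equivariant f_linear unfolding tensor_relators_def
      by (auto simp: lext_diff lext_scale linear_maps_add [OF f_linear] linear_maps_smult [OF f_linear]
          f_closed equivariant_maps_def W.relators_in_relations)
    then show "tensor_relators G M ract V lactV \<subseteq> ?R"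
      using V.tensor_relators_subset by blast
    show "submodule ?R ring_of_type_algebra (free_module (carrier M \<times> carrier V))"
      unfolding submodule_free_module_iff
      by (intro conjI ballI allI subsetI)
        (simp_all add: W.relations_closed linear_extension_add lext_scale keys_add_subset keys_scale_subset)
  qed
  with assms show ?thesis by blast
qed

lemma tensored_coset:
  assumes "Poly_Mapping.keys p \<subseteq> carrier M \<times> carrier V"
  shows "tensored (V.relations +>\<^bsub>free_module (carrier M \<times> carrier V)\<^esub> p) =
    W.relations +>\<^bsub>free_module (carrier M \<times> carrier W)\<^esub> tensor_map f p"
  unfolding group_tensor_map_def
proof (rule V.coset_Union)
  fix r assume "r \<in> V.relations"
  then show "W.relations +>\<^bsub>free_module (carrier M \<times> carrier W)\<^esub>
        tensor_map f (r \<oplus>\<^bsub>free_module (carrier M \<times> carrier V)\<^esub> p) =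
      W.relations +>\<^bsub>free_module (carrier M \<times> carrier W)\<^esub> tensor_map f p"
    using assms
    by (intro W.relations_coset_eqI)
      (simp_all add: linear_extension_add tensor_map_relations tensor_map_closed)
qed (use assms in simp)

lemma tensored_linear:
  "tensored \<in> linear_maps (group_tensor G M ract V lactV) (group_tensor G M ract W lactW)"
  unfolding linear_maps_def group_tensor_def V.quotient_simps(1) W.quotient_simps(1)
  by (auto simp: tensored_coset tensor_map_closed V.quotient_simps W.quotient_simps
      keys_add_subset keys_scale_subset linear_extension_add lext_scale)
    (use tensor_map_closed in blast)

end

lemma tensor_morphismI:
  assumes "tensor_pair M V G ract lactV" "tensor_pair M W G ract lactW"
    "f \<in> equivariant_maps G V lactV W lactW"
  shows "tensor_morphism M V W G ract lactV lactW f"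
  using assms by (simp add: tensor_morphism_def tensor_morphism_axioms_def)

context tensor_pair
begin

lemma group_tensor_cases:
  assumes "Q \<in> carrier (group_tensor G M ract V lact)"
  obtains p where "Poly_Mapping.keys p \<subseteq> carrier M \<times> carrier V"
    "Q = relations +>\<^bsub>free_module (carrier M \<times> carrier V)\<^esub> p"
  using assms unfolding group_tensor_def quotient_simps by auto

lemma module_group_tensor: "module ring_of_type_algebra (group_tensor G M ract V lact)"
  unfolding group_tensor_def by (rule module_quotient)

end

text \<open>\<open>h\<close> is a separate parameter so that it may be any map agreeing with the
  composite on the carrier, for instance a constant zero map.\<close>

lemma group_tensor_map_compose:
  assumes f: "tensor_morphism M V W G ract lactV lactW f"
    and g: "tensor_morphism M W U G ract lactW lactU g"
    and h: "tensor_morphism M V U G ract lactV lactU h"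
    and eq: "\<And>v. v \<in> carrier V \<Longrightarrow> h v = g (f v)"
    and Q: "Q \<in> carrier (group_tensor G M ract V lactV)"
  shows "group_tensor_map G M ract U lactU g (group_tensor_map G M ract W lactW f Q) =
    group_tensor_map G M ract U lactU h Q"
proof -
  interpret f: tensor_morphism M V W G ract lactV lactW f by fact
  interpret g: tensor_morphism M W U G ract lactW lactU g by fact
  interpret h: tensor_morphism M V U G ract lactV lactU h by fact
  obtain p where p: "Poly_Mapping.keys p \<subseteq> carrier M \<times> carrier V"
    "Q = f.V.relations +>\<^bsub>free_module (carrier M \<times> carrier V)\<^esub> p"
    using Q by (rule f.V.group_tensor_cases)
  have "tensor_map g (tensor_map f p) = tensor_map h p"
    using p(1) eq by (auto simp: lext_lext intro!: lext_cong)
  with p show ?thesis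
    by (simp add: f.tensored_coset g.tensored_coset h.tensored_coset f.tensor_map_closed)
qed

lemma group_tensor_map_add:
  assumes f: "tensor_morphism M V W G ract lactV lactW f"
    and g: "tensor_morphism M V W G ract lactV lactW g"
    and h: "tensor_morphism M V W G ract lactV lactW h"
    and eq: "\<And>v. v \<in> carrier V \<Longrightarrow> h v = f v \<oplus>\<^bsub>W\<^esub> g v"
    and Q: "Q \<in> carrier (group_tensor G M ract V lactV)"
  shows "group_tensor_map G M ract W lactW h Q =
    group_tensor_map G M ract W lactW f Q \<oplus>\<^bsub>group_tensor G M ract W lactW\<^esub>
    group_tensor_map G M ract W lactW g Q"
proof -
  interpret f: tensor_morphism M V W G ract lactV lactW f by fact
  interpret g: tensor_morphism M V W G ract lactV lactW g by fact
  interpret h: tensor_morphism M V W G ract lactV lactW h by fact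
  obtain p where p: "Poly_Mapping.keys p \<subseteq> carrier M \<times> carrier V"
    "Q = f.V.relations +>\<^bsub>free_module (carrier M \<times> carrier V)\<^esub> p"
    using Q by (rule f.V.group_tensor_cases)
  \<comment> \<open>Before passing to classes, \<open>tensor_map\<close> is not additive in the map;
    the defect is a combination of the additivity relators in the second factor.\<close>
  have "tensor_map h p - (tensor_map f p + tensor_map g p) =
      lext (\<lambda>(x, v). basis_vec (x, f v \<oplus>\<^bsub>W\<^esub> g v) - basis_vec (x, f v) - basis_vec (x, g v)) p"
    unfolding lext_fun_add [symmetric] lext_fun_diff [symmetric]
    using p(1) eq by (auto intro!: lext_cong)
  also have "\<dots> \<in> f.W.relations"
    using p(1) by (auto intro!: f.W.lext_in_relations f.W.relators_in_relations f.f_closed g.f_closed)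
  finally show ?thesis
    unfolding group_tensor_def p(2) f.tensored_coset [OF p(1)] g.tensored_coset [OF p(1)]
      h.tensored_coset [OF p(1)]
    using f.tensor_map_closed [OF p(1)] g.tensor_map_closed [OF p(1)]
    by (simp add: f.W.quotient_simps f.W.relations_coset_eqI keys_add_subset)
qed

lemma group_tensor_map_id:
  assumes f: "tensor_morphism M V V G ract lactV lactV f"
    and eq: "\<And>v. v \<in> carrier V \<Longrightarrow> f v = v"
    and Q: "Q \<in> carrier (group_tensor G M ract V lactV)"
  shows "group_tensor_map G M ract V lactV f Q = Q"
proof -
  interpret f: tensor_morphism M V V G ract lactV lactV f by fact
  obtain p where p: "Poly_Mapping.keys p \<subseteq> carrier M \<times> carrier V"
    "Q = f.V.relations +>\<^bsub>free_module (carrier M \<times> carrier V)\<^esub> p"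
    using Q by (rule f.V.group_tensor_cases)
  have "tensor_map f p = lext basis_vec p"
    using p(1) eq by (intro lext_cong) auto
  with p show ?thesis
    by (simp add: f.tensored_coset)
qed

lemma group_tensor_map_zero:
  assumes f: "tensor_morphism M V W G ract lactV lactW f"
    and eq: "\<And>v. v \<in> carrier V \<Longrightarrow> f v = \<zero>\<^bsub>W\<^esub>"
    and Q: "Q \<in> carrier (group_tensor G M ract V lactV)"
  shows "group_tensor_map G M ract W lactW f Q = \<zero>\<^bsub>group_tensor G M ract W lactW\<^esub>"
proof -
  interpret f: tensor_morphism M V W G ract lactV lactW f by fact
  obtain p where p: "Poly_Mapping.keys p \<subseteq> carrier M \<times> carrier V"
    "Q = f.V.relations +>\<^bsub>free_module (carrier M \<times> carrier V)\<^esub> p"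
    using Q by (rule f.V.group_tensor_cases)
  \<comment> \<open>For the scalar 0 the homogeneity relator is the pair itself.\<close>
  have "basis_vec (x, \<zero>\<^bsub>W\<^esub>) \<in> f.W.relations" if "x \<in> carrier M" for x
    using f.W.relators_in_relations(4) [OF that, of "\<zero>\<^bsub>W\<^esub>" 0] by simp
  then have "tensor_map f p \<in> f.W.relations"
    using p(1) eq by (intro f.W.lext_in_relations) auto
  then show ?thesis
    unfolding group_tensor_def p(2) f.tensored_coset [OF p(1)]
    by (simp add: f.W.quotient_simps f.W.coset_eq_W)
qed


section \<open>Averaging over the symmetric group\<close>

abbreviation perms :: "nat \<Rightarrow> (nat \<Rightarrow> nat) set" where
  "perms n \<equiv> {\<sigma>. \<sigma> permutes {1..n}}"

abbreviation vars :: "nat \<Rightarrow> nat list" where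
  "vars n \<equiv> [1..<Suc n]"

lemma sum_list_var_word: "sum_list (var_word (vars n)) = all_ones n"
  unfolding all_ones_def by (simp add: interv_sum_list_conv_sum_set_nat atLeastLessThanSuc_atLeastAtMost
      del: upt_Suc)

lemma lookup_all_ones: "Poly_Mapping.lookup (all_ones n) i = (if i \<in> {1..n} then 1 else 0)"
  by (simp add: all_ones_def lookup_sum lookup_single when_def)

lemma perms_set_vars: "\<sigma> \<in> perms n \<Longrightarrow> \<sigma> permutes set (vars n)"
  by (simp only: set_upt atLeastLessThanSuc_atLeastAtMost mem_Collect_eq)

lemma bij_perms: "\<sigma> \<in> perms n \<Longrightarrow> bij \<sigma>"
  by (simp add: permutes_bij)

lemma rename_vars_all_ones: "\<sigma> \<in> perms n \<Longrightarrow> rename_vars \<sigma> (all_ones n) = all_ones n"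
  by (intro poly_mapping_eqI)
    (simp add: lookup_rename_vars bij_perms lookup_all_ones permutes_in_image permutes_inv
      del: atLeastAtMost_iff)

lemma sign_perms_square:
  "of_int (sign \<sigma>) * (of_int (sign \<sigma>) :: 'k::field) = 1"
  by (simp flip: of_int_mult)

definition average ::
  "nat \<Rightarrow> ((nat \<Rightarrow> nat) \<Rightarrow> monomial list \<Rightarrow>\<^sub>0 'k::field) \<Rightarrow> monomial list \<Rightarrow>\<^sub>0 'k" where
  "average n F = scale (inverse (of_nat (card (perms n)))) (\<Sum>\<sigma>\<in>perms n. F \<sigma>)"

lemma card_perms_neq_0: "of_nat (card (perms n)) \<noteq> (0 :: 'k::field_char_0)"
  using card_permutations [of "{1..n}" n] by simp

lemma sum_const_scale: "(\<Sum>i\<in>I. p) = scale (of_nat (card I)) p"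
  by (induction I rule: infinite_finite_induct) (simp_all add: scale_add add.commute)

lemma average_const: "average n (\<lambda>\<sigma>. p) = (p :: _ \<Rightarrow>\<^sub>0 'k::field_char_0)"
  using card_perms_neq_0 [of n, where 'k = 'k]
  by (simp add: average_def sum_const_scale scale_scale)

lemma average_linear:
  "average n (\<lambda>\<sigma>. F \<sigma> + F' \<sigma>) = average n F + average n F'"
  "average n (\<lambda>\<sigma>. F \<sigma> - F' \<sigma>) = average n F - average n F'"
  "average n (\<lambda>\<sigma>. scale c (F \<sigma>)) = scale c (average n F)"
  by (simp_all add: average_def sum.distrib sum_subtractf scale_simps scale_commute [of c]
      flip: scale_sum_right)

lemma average_image:
  assumes "\<And>p q. f (p + q) = f p + f q" "\<And>c p. f (scale c p) = scale c (f p)"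
  shows "f (average n F) = average n (\<lambda>\<sigma>. f (F \<sigma>))"
proof -
  have "f 0 = 0" using assms(2) [of 0 0] by simp
  then have "f (sum F I) = (\<Sum>\<sigma>\<in>I. f (F \<sigma>))" for I
    by (induction I rule: infinite_finite_induct) (simp_all add: assms)
  then show ?thesis by (simp add: average_def assms)
qed

lemma average_cong: "(\<And>\<sigma>. \<sigma> \<in> perms n \<Longrightarrow> F \<sigma> = F' \<sigma>) \<Longrightarrow> average n F = average n F'"
  unfolding average_def by (intro arg_cong [where f = "scale _"] sum.cong refl)

lemma average_reindex: "\<tau> \<in> perms n \<Longrightarrow> average n (\<lambda>\<sigma>. F (\<tau> \<circ> \<sigma>)) = average n F"
  unfolding average_def by (subst setum_permutations_compose_left [of \<tau> "{1..n}" F]) simp_all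

lemma keys_average_subset:
  "(\<And>\<sigma>. \<sigma> \<in> perms n \<Longrightarrow> Poly_Mapping.keys (F \<sigma>) \<subseteq> A) \<Longrightarrow> Poly_Mapping.keys (average n F) \<subseteq> A"
  unfolding average_def by (intro keys_scale_subset keys_sum_subset)

text \<open>Each conjugate of the contraction by \<sigma> is the contraction for another order of
  the variables.\<close>

definition equivariant_htp :: "nat \<Rightarrow> (monomial list \<Rightarrow>\<^sub>0 'k::field) \<Rightarrow> monomial list \<Rightarrow>\<^sub>0 'k" where
  "equivariant_htp n p =
     average n (\<lambda>\<sigma>. cobar_act \<sigma> (lext (iterated_htp (vars n)) (cobar_act (inv' \<sigma>) p)))"

text \<open>The antisymmetrization of x_1 \<otimes> ... \<otimes> x_n, normalised so that the
  coefficient functional takes the value 1.\<close>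

definition alternating_word :: "nat \<Rightarrow> monomial list \<Rightarrow>\<^sub>0 'k::field" where
  "alternating_word n =
     average n (\<lambda>\<sigma>. scale (of_int (sign \<sigma>)) (cobar_act \<sigma> (basis_vec (var_word (vars n)))))"

lemma equivariant_htp_linear:
  "equivariant_htp n (p + q) = equivariant_htp n p + equivariant_htp n q"
  "equivariant_htp n (scale c p) = scale c (equivariant_htp n p)"
  by (simp_all add: equivariant_htp_def cobar_act_linear linear_extension_add lext_scale average_linear)

text \<open>Replace \<sigma> by \<tau> \<sigma> in the average and use (\<tau> \<sigma>)^-1 \<tau> =
  \<sigma>^-1.\<close>

lemma equivariant_htp_cobar_act:
  assumes \<tau>: "\<tau> \<in> perms n"
  shows "equivariant_htp n (cobar_act \<tau> p) = cobar_act \<tau> (equivariant_htp n p)"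
proof -
  let ?F = "\<lambda>\<sigma>. cobar_act \<sigma> (lext (iterated_htp (vars n)) (cobar_act (inv' \<sigma>) (cobar_act \<tau> p)))"
  have "?F (\<tau> \<circ> \<sigma>) = cobar_act \<tau> (cobar_act \<sigma> (lext (iterated_htp (vars n)) (cobar_act (inv' \<sigma>) p)))"
    if "\<sigma> \<in> perms n" for \<sigma>
  proof -
    have bij: "bij \<sigma>" "bij \<tau>" using that \<tau> by (auto intro: bij_perms)
    then have "inv' (\<tau> \<circ> \<sigma>) \<circ> \<tau> = inv' \<sigma>"
      by (simp add: o_inv_distrib comp_assoc bij_is_inj)
    then have "cobar_act (inv' (\<tau> \<circ> \<sigma>)) (cobar_act \<tau> p) = cobar_act (inv' \<sigma>) p"
      using bij by (metis bij_comp bij_imp_bij_inv cobar_act_comp)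
    then show ?thesis using bij by (simp add: cobar_act_comp)
  qed
  then show ?thesis
    unfolding equivariant_htp_def average_reindex [OF \<tau>, of ?F, symmetric]
    by (subst average_image [where f = "cobar_act \<tau>"]) (auto simp: cobar_act_linear intro!: average_cong)
qed

lemma cobar_act_alternating_word:
  assumes \<tau>: "\<tau> \<in> perms n"
  shows "cobar_act \<tau> (alternating_word n) = scale (of_int (sign \<tau>)) (alternating_word n)"
proof -
  let ?b = "basis_vec (var_word (vars n))"
  let ?F = "\<lambda>\<sigma>. scale (of_int (sign \<sigma>)) (cobar_act \<sigma> ?b)"
  have "cobar_act \<tau> (?F \<sigma>) = scale (of_int (sign \<tau>)) (?F (\<tau> \<circ> \<sigma>))" if "\<sigma> \<in> perms n" for \<sigma>
  proof -
    have "permutation \<sigma>" "permutation \<tau>"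
      using that \<tau> by (auto simp: permutation_permutes)
    then have "sign \<tau> * sign (\<tau> \<circ> \<sigma>) = sign \<sigma>"
      by (simp add: sign_compose)
    then have "of_int (sign \<tau>) * of_int (sign (\<tau> \<circ> \<sigma>)) = (of_int (sign \<sigma>) :: 'b)"
      by (simp only: flip: of_int_mult)
    then show ?thesis
      using that \<tau> by (simp only: cobar_act_linear scale_scale cobar_act_comp bij_perms)
  qed
  then have "cobar_act \<tau> (alternating_word n) = average n (\<lambda>\<sigma>. scale (of_int (sign \<tau>)) (?F (\<tau> \<circ> \<sigma>)))"
    unfolding alternating_word_def
    by (subst average_image) (auto simp: cobar_act_linear intro!: average_cong)
  then show ?thesis
    unfolding average_linear(3) average_reindex [OF \<tau>, of ?F] by (simp add: alternating_word_def)
qed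

text \<open>All blocks are primitive, so \<open>bidiff\<close> vanishes on each of them.\<close>

lemma cobar_diff_var_word: "cobar_diff (basis_vec (var_word xs)) = 0"
  by (induction xs)
    (simp_all add: cobar_diff_def cobar_diff_basis_Nil cobar_diff_basis_Cons bidiff_var [simplified] prepend2_def
      prepend_linear)

lemma cobar_diff_alternating_word: "cobar_diff (alternating_word n) = 0"
proof -
  have "cobar_diff (alternating_word n :: _ \<Rightarrow>\<^sub>0 'k::field) = average n (\<lambda>\<sigma>. scale 0 0)"
    unfolding alternating_word_def
    by (subst average_image)
      (auto simp: cobar_diff_linear cobar_diff_cobar_act bij_perms cobar_diff_var_word cobar_act_linear
        simp del: cobar_act_basis_vec upt_Suc One_nat_def intro!: average_cong)
  then show ?thesis by (simp add: average_def)
qed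

text \<open>Every summand contributes 1, since the sign in the definition meets the sign produced by
  the functional.\<close>

lemma word_coeff_alternating_word:
  "word_coeff (vars n) (alternating_word n) = (1 :: 'k::field_char_0)"
proof -
  let ?b = "basis_vec (var_word (vars n)) :: _ \<Rightarrow>\<^sub>0 'k"
  have "of_int (sign \<sigma>) * word_coeff (vars n) (cobar_act \<sigma> ?b) = 1" if "\<sigma> \<in> perms n" for \<sigma>
    using word_coeff_cobar_act [OF perms_set_vars [OF that], of ?b] word_coeff_var_word [of "vars n", where 'a = 'k]
    by (simp add: sign_perms_square flip: mult.assoc del: cobar_act_basis_vec upt_Suc)
  then have "word_coeff (vars n) (alternating_word n :: _ \<Rightarrow>\<^sub>0 'k) =
      inverse (of_nat (card (perms n))) * of_nat (card (perms n))"
    unfolding alternating_word_def average_def word_coeff_linear by simp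
  then show ?thesis
    using card_perms_neq_0 [of n, where 'k = 'k] by simp
qed

section \<open>The averaged homotopy in multidegree (1, ..., 1)\<close>

definition words :: "nat \<Rightarrow> nat \<Rightarrow> monomial list set" where
  "words n m = {us. length us = m \<and> sum_list us = all_ones n}"

lemma keys_cobar_act:
  assumes "\<sigma> \<in> perms n" "Poly_Mapping.keys p \<subseteq> words n m"
  shows "Poly_Mapping.keys (cobar_act \<sigma> p) \<subseteq> words n m"
  unfolding cobar_act_def using assms(2)
  by (intro keys_lext_subset)
    (auto simp: words_def sum_list_map_rename_vars bij_perms [OF assms(1)] rename_vars_all_ones [OF assms(1)])

lemma keys_cobar_diff:
  "Poly_Mapping.keys p \<subseteq> words n m \<Longrightarrow> Poly_Mapping.keys (cobar_diff p) \<subseteq> words n (Suc m)"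
  unfolding cobar_diff_def
  by (intro keys_lext_subset) (auto simp: words_def dest!: keys_cobar_diff_basis)

lemma inv_perms: "\<sigma> \<in> perms n \<Longrightarrow> inv' \<sigma> \<in> perms n"
  by (simp add: permutes_inv)

lemma keys_equivariant_htp:
  assumes "Poly_Mapping.keys p \<subseteq> words n (Suc m)"
  shows "Poly_Mapping.keys (equivariant_htp n p) \<subseteq> words n m"
  unfolding equivariant_htp_def
proof (intro keys_average_subset keys_cobar_act keys_lext_subset subsetI)
  fix \<sigma> us w assume "\<sigma> \<in> perms n" "us \<in> Poly_Mapping.keys (cobar_act (inv' \<sigma>) p)"
    and w: "w \<in> Poly_Mapping.keys (iterated_htp (vars n) us :: _ \<Rightarrow>\<^sub>0 'a)"
  then have "us \<in> words n (Suc m)"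
    using keys_cobar_act [OF inv_perms assms] by blast
  then show "w \<in> words n m"
    using keys_iterated_htp [OF w] by (simp add: words_def sum_list_var_word del: upt_Suc One_nat_def)
qed

lemma keys_alternating_word: "Poly_Mapping.keys (alternating_word n) \<subseteq> words n n"
  unfolding alternating_word_def
  by (intro keys_average_subset keys_scale_subset keys_cobar_act)
    (auto simp: words_def sum_list_var_word simp del: upt_Suc One_nat_def)

text \<open>Conjugate the identity for the sorted order by each \<sigma> and average. The functional
  yields \<open>sign \<sigma>\<close> on the translate of p by \<sigma>^-1, and this sign together
  with the \<sigma>-translate of the sorted word is a summand of
  \<open>alternating_word\<close>.\<close>

lemma equivariant_htp_cobar_diff:
  fixes p :: "monomial list \<Rightarrow>\<^sub>0 'k::field_char_0"
  assumes p: "Poly_Mapping.keys p \<subseteq> words n m"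
  shows "cobar_diff (equivariant_htp n p) + equivariant_htp n (cobar_diff p) =
    p - scale (word_coeff (vars n) p) (alternating_word n)"
proof -
  let ?K = "lext (iterated_htp (vars n)) :: _ \<Rightarrow> _ \<Rightarrow>\<^sub>0 'k"
  let ?b = "basis_vec (var_word (vars n)) :: _ \<Rightarrow>\<^sub>0 'k"
  have K: "cobar_diff (?K q) + ?K (cobar_diff q) = q - scale (word_coeff (vars n) q) ?b"
    if "Poly_Mapping.keys q \<subseteq> words n m" for q
  proof -
    have "cobar_diff (?K q) + ?K (cobar_diff q) =
        lext (\<lambda>w. cobar_diff (iterated_htp (vars n) w) + ?K (cobar_diff_basis w)) q"
      by (simp add: cobar_diff_def lext_lext lext_fun_add)
    also have "\<dots> = lext (\<lambda>w. basis_vec w - scale (word_coeff (vars n) (basis_vec w)) ?b) q"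
      using that by (intro lext_cong iterated_htp_cobar_diff) (auto simp: words_def sum_list_var_word simp del: upt_Suc One_nat_def)
    finally show ?thesis
      by (simp add: lext_fun_diff flip: scale_word_coeff)
  qed
  have "cobar_diff (equivariant_htp n p) + equivariant_htp n (cobar_diff p) =
      average n (\<lambda>\<sigma>. cobar_diff (cobar_act \<sigma> (?K (cobar_act (inv' \<sigma>) p)))
        + cobar_act \<sigma> (?K (cobar_act (inv' \<sigma>) (cobar_diff p))))"
    unfolding equivariant_htp_def average_linear
    by (subst average_image [where f = cobar_diff]) (simp_all add: cobar_diff_linear)
  also have "\<dots> = average n (\<lambda>\<sigma>. p - scale (word_coeff (vars n) p)
      (scale (of_int (sign \<sigma>)) (cobar_act \<sigma> ?b)))"
  proof (rule average_cong)
    fix \<sigma> assume \<sigma>: "\<sigma> \<in> perms n"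
    then have bij: "bij \<sigma>" "bij (inv' \<sigma>)" by (simp_all only: bij_perms bij_imp_bij_inv)
    have "permutation \<sigma>"
      using \<sigma> by (auto simp: permutation_permutes)
    then have sign: "sign (inv' \<sigma>) = sign \<sigma>" by (rule sign_inverse)
    let ?q = "cobar_act (inv' \<sigma>) p"
    have q: "cobar_act \<sigma> ?q = p"
      using cobar_act_comp [OF bij, of p] bij_is_surj [OF bij(1)] by (simp add: surj_iff)
    have w: "word_coeff (vars n) ?q = of_int (sign \<sigma>) * word_coeff (vars n) p"
      using word_coeff_cobar_act [OF perms_set_vars [OF inv_perms [OF \<sigma>]], of p] sign by simp
    have "cobar_diff (cobar_act \<sigma> (?K ?q)) + cobar_act \<sigma> (?K (cobar_act (inv' \<sigma>) (cobar_diff p))) =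
        cobar_act \<sigma> (cobar_diff (?K ?q) + ?K (cobar_diff ?q))"
      using bij by (simp add: cobar_diff_cobar_act cobar_act_linear)
    also have "\<dots> = cobar_act \<sigma> (?q - scale (word_coeff (vars n) ?q) ?b)"
      using K [OF keys_cobar_act [OF inv_perms [OF \<sigma>] p]] by (rule arg_cong)
    also have "\<dots> = p - scale (word_coeff (vars n) p) (scale (of_int (sign \<sigma>)) (cobar_act \<sigma> ?b))"
      unfolding cobar_act_linear q w by (simp only: scale_scale mult.commute)
    finally show "cobar_diff (cobar_act \<sigma> (?K ?q)) + cobar_act \<sigma> (?K (cobar_act (inv' \<sigma>) (cobar_diff p))) =
      p - scale (word_coeff (vars n) p) (scale (of_int (sign \<sigma>)) (cobar_act \<sigma> ?b))" .
  qed
  also have "\<dots> = p - scale (word_coeff (vars n) p) (alternating_word n)"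
    by (simp only: average_linear average_const alternating_word_def)
  finally show ?thesis .
qed

lemma word_coeff_vars_cobar_diff:
  assumes "Poly_Mapping.keys p \<subseteq> words n m"
  shows "word_coeff (vars n) (cobar_diff p) = 0"
  unfolding cobar_diff_def using assms
  by (intro word_coeff_lext_eq_0 word_coeff_cobar_diff)
    (auto simp: words_def sum_list_var_word simp del: upt_Suc One_nat_def)

lemma word_coeff_vars_eq_0:
  fixes p :: "monomial list \<Rightarrow>\<^sub>0 'k::field"
  assumes "Poly_Mapping.keys p \<subseteq> words n m" "m \<noteq> n"
  shows "word_coeff (vars n) p = 0"
  using assms by (auto simp: words_def intro!: word_coeff_eq_0 [of p] word_coeff_length)

text \<open>Exponents are natural numbers and cannot cancel in the sum, so the multidegree already
  confines every block to x_1, ..., x_n.\<close>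

lemma cobar_part_all_ones: "cobar_part n (all_ones n) m = free_module (words n m)"
proof -
  have "Poly_Mapping.keys u \<subseteq> {1..n}" if "u \<in> set us" "sum_list us = all_ones n" for u us
  proof -
    have "Poly_Mapping.lookup u i \<le> Poly_Mapping.lookup (sum_list us) i" for i
      using that(1) by (induction us) (auto simp: lookup_add intro: trans_le_add2)
    then have le: "Poly_Mapping.lookup u i \<le> (if i \<in> {1..n} then 1 else 0)" for i
      unfolding that(2) lookup_all_ones .
    show ?thesis
    proof
      fix i assume "i \<in> Poly_Mapping.keys u"
      then show "i \<in> {1..n}"
        using le [of i] by (cases "i \<in> {1..n}") (simp_all only: in_keys_iff if_True if_False le_zero_eq)
    qed
  qed
  then have "{p. Poly_Mapping.keys p \<subseteq> cobar_basis n m \<and> (\<forall>us\<in>Poly_Mapping.keys p. sum_list us = all_ones n)}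
      = {p :: _ \<Rightarrow>\<^sub>0 'a. Poly_Mapping.keys p \<subseteq> words n m}"
    unfolding cobar_basis_def words_def by blast
  then show ?thesis
    by (simp add: cobar_part_def cobar_def) (simp add: free_module_def)
qed


section \<open>The cohomology of the cubical complex\<close>

lemma linear_maps_minus:
  assumes "module ring_of_type_algebra V" "module ring_of_type_algebra W" "f \<in> linear_maps V W"
    and "x \<in> carrier V" "y \<in> carrier V"
  shows "f (x \<ominus>\<^bsub>V\<^esub> y) = f x \<ominus>\<^bsub>W\<^esub> f y"
proof -
  interpret V: module ring_of_type_algebra V by fact
  interpret W: module ring_of_type_algebra W by fact
  have y: "f y \<in> carrier W" "f (\<ominus>\<^bsub>V\<^esub> y) \<in> carrier W"
    using assms by (auto intro: linear_maps_closed)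
  have "f (\<ominus>\<^bsub>V\<^esub> y) \<oplus>\<^bsub>W\<^esub> f y = f (\<ominus>\<^bsub>V\<^esub> y \<oplus>\<^bsub>V\<^esub> y)"
    using assms(3,5) by (simp add: linear_maps_add)
  also have "\<dots> = \<zero>\<^bsub>W\<^esub>"
    using linear_maps_zero [OF assms(1-3)] assms(5) by (simp add: V.M.l_neg)
  finally have "\<ominus>\<^bsub>W\<^esub> f y = f (\<ominus>\<^bsub>V\<^esub> y)"
    using y by (intro W.M.minus_equality)
  then show ?thesis
    using assms(3-5) by (simp add: a_minus_def linear_maps_add)
qed

lemma submodule_image:
  assumes "module ring_of_type_algebra V" "module ring_of_type_algebra W" "f \<in> linear_maps V W"
  shows "submodule (f ` carrier V) ring_of_type_algebra W"
proof -
  interpret V: module ring_of_type_algebra V by fact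
  interpret W: module ring_of_type_algebra W by fact
  note zero = linear_maps_zero [OF assms]
  show ?thesis
  proof (rule W.submoduleI)
    show "f ` carrier V \<subseteq> carrier W"
      using assms(3) by (auto intro: linear_maps_closed)
    show "\<zero>\<^bsub>W\<^esub> \<in> f ` carrier V"
      using zero by (metis V.M.zero_closed imageI)
    show "\<ominus>\<^bsub>W\<^esub> y \<in> f ` carrier V" if y: "y \<in> f ` carrier V" for y
    proof -
      obtain x where x: "x \<in> carrier V" "y = f x" using y by blast
      have "f (\<zero>\<^bsub>V\<^esub> \<ominus>\<^bsub>V\<^esub> x) = \<zero>\<^bsub>W\<^esub> \<ominus>\<^bsub>W\<^esub> f x"
        using linear_maps_minus [OF assms V.M.zero_closed x(1)] zero by simp
      then have "\<ominus>\<^bsub>W\<^esub> y = f (\<ominus>\<^bsub>V\<^esub> x)"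
        using x linear_maps_closed [OF assms(3) x(1)] by (simp add: a_minus_def)
      then show ?thesis using x by auto
    qed
    show "y \<oplus>\<^bsub>W\<^esub> z \<in> f ` carrier V" if "y \<in> f ` carrier V" "z \<in> f ` carrier V" for y z
      using that linear_maps_add [OF assms(3)] by (auto simp flip: linear_maps_add [OF assms(3)])
    show "c \<odot>\<^bsub>W\<^esub> y \<in> f ` carrier V"
      if "c \<in> carrier ring_of_type_algebra" "y \<in> f ` carrier V" for c y
      using that V.smult_closed by (auto simp flip: linear_maps_smult [OF assms(3)])
  qed
qed

lemma submodule_zero:
  assumes "module ring_of_type_algebra V"
  shows "submodule {\<zero>\<^bsub>V\<^esub>} ring_of_type_algebra V"
proof -
  interpret V: module ring_of_type_algebra V by fact
  show ?thesis by (rule V.submoduleI) (use V.smult_r_null in auto)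
qed

lemma module_sgn: "module ring_of_type_algebra (sgn_module :: ('k::field, 'k) module)"
proof (rule moduleI)
  show "abelian_group (sgn_module :: ('k, 'k) module)"
    by (rule abelian_groupI) (auto simp: sgn_module_def intro: exI [of _ "- _"])
qed (simp_all add: sgn_module_def algebra_simps cring_from_type_algebra)

section \<open>Transport of the homotopy to the cubical complex\<close>

locale cubical =
  fixes n :: nat
    and G :: "(nat \<Rightarrow> nat) set"
    and M :: "('k::field_char_0, 'm) module"
    and ract :: "'m \<Rightarrow> (nat \<Rightarrow> nat) \<Rightarrow> 'm"
  assumes n: "n \<ge> 1"
    and G: "G \<subseteq> perms n"
    and M: "module ring_of_type_algebra M"
    and ract_closed: "x \<in> carrier M \<Longrightarrow> g \<in> G \<Longrightarrow> ract x g \<in> carrier M"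
begin

abbreviation "C m \<equiv> free_module (words n m) :: ('k, monomial list \<Rightarrow>\<^sub>0 'k) module"
abbreviation "N m \<equiv> group_tensor G M ract (C m) cobar_act"
abbreviation "T \<equiv> group_tensor G M ract sgn_module sgn_act"
abbreviation "D m \<equiv> group_tensor_map G M ract (C (Suc m)) cobar_act cobar_diff"
abbreviation "tensor_htp m \<equiv> group_tensor_map G M ract (C m) cobar_act (equivariant_htp n)"
abbreviation "tensor_coeff \<equiv> group_tensor_map G M ract sgn_module sgn_act (word_coeff (vars n))"
abbreviation "alternating \<equiv>
  group_tensor_map G M ract (C n) cobar_act (\<lambda>c. scale c (alternating_word n))"

lemma Cub_eq: "Cub n G M ract = N"
  by (simp add: fun_eq_iff Cub_def cobar_part_all_ones)

lemma Cub_diff_eq: "Cub_diff n G M ract = D"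
  by (simp add: fun_eq_iff Cub_diff_def cobar_part_all_ones)

lemma pair_C: "tensor_pair M (C m) G ract cobar_act"
  using M ract_closed G by (intro tensor_pairI module_free_module) (auto simp: keys_cobar_act [THEN subsetD])

lemma pair_sgn: "tensor_pair M sgn_module G ract sgn_act"
  using M ract_closed by (intro tensor_pairI module_sgn) (auto simp: sgn_module_def)

lemma module_N: "module ring_of_type_algebra (N m)"
  by (rule tensor_pair.module_group_tensor [OF pair_C])

lemma module_T: "module ring_of_type_algebra T"
  by (rule tensor_pair.module_group_tensor [OF pair_sgn])

text \<open>Commutation is asked for all of S_n, which the averaging provides, and is then
  restricted to G.\<close>

lemma morphism_C_C:
  assumes "\<And>p. Poly_Mapping.keys p \<subseteq> words n m \<Longrightarrow> Poly_Mapping.keys (f p) \<subseteq> words n m'"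
    and "\<And>p q. f (p + q) = f p + f q" "\<And>c p. f (scale c p) = scale c (f p)"
    and "\<And>\<sigma> p. \<sigma> \<in> perms n \<Longrightarrow> f (cobar_act \<sigma> p) = cobar_act \<sigma> (f p)"
  shows "tensor_morphism M (C m) (C m') G ract cobar_act cobar_act f"
  using assms G
  by (intro tensor_morphismI pair_C) (auto simp: equivariant_maps_def linear_maps_def subset_iff [of G])

lemma morphism_diff: "tensor_morphism M (C m) (C (Suc m)) G ract cobar_act cobar_act cobar_diff"
  by (rule morphism_C_C) (simp_all only: keys_cobar_diff cobar_diff_linear cobar_diff_cobar_act bij_perms)

lemma morphism_htp:
  "tensor_morphism M (C (Suc m)) (C m) G ract cobar_act cobar_act (equivariant_htp n)"
  by (rule morphism_C_C)
    (simp_all only: keys_equivariant_htp equivariant_htp_linear equivariant_htp_cobar_act)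

lemma morphism_diff_htp:
  "tensor_morphism M (C (Suc m)) (C (Suc m)) G ract cobar_act cobar_act
     (\<lambda>p. cobar_diff (equivariant_htp n p))"
  by (rule morphism_C_C) (simp_all only: keys_cobar_diff cobar_diff_linear cobar_diff_cobar_act bij_perms
      keys_equivariant_htp equivariant_htp_linear equivariant_htp_cobar_act)

lemma morphism_htp_diff:
  "tensor_morphism M (C m) (C m) G ract cobar_act cobar_act
     (\<lambda>p. equivariant_htp n (cobar_diff p))"
  by (rule morphism_C_C) (simp_all only: keys_cobar_diff cobar_diff_linear cobar_diff_cobar_act bij_perms
      keys_equivariant_htp equivariant_htp_linear equivariant_htp_cobar_act)

lemma morphism_sum:
  "tensor_morphism M (C (Suc m)) (C (Suc m)) G ract cobar_act cobar_act
     (\<lambda>p. cobar_diff (equivariant_htp n p) + equivariant_htp n (cobar_diff p))"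
  by (rule morphism_C_C) (simp_all only: keys_add_subset scale_add_right keys_cobar_diff cobar_diff_linear
      cobar_act_linear cobar_diff_cobar_act bij_perms keys_equivariant_htp equivariant_htp_linear
      equivariant_htp_cobar_act ac_simps)

lemma morphism_id: "tensor_morphism M (C m) (C m) G ract cobar_act cobar_act (\<lambda>p. p)"
  by (rule morphism_C_C) simp_all

lemma word_coeff_vars_cobar_act:
  "\<sigma> \<in> perms n \<Longrightarrow> word_coeff (vars n) (cobar_act \<sigma> p) = sgn_act \<sigma> (word_coeff (vars n) p :: 'k)"
  by (simp only: word_coeff_cobar_act perms_set_vars distinct_upt sgn_act_def)

lemma morphism_coeff:
  "tensor_morphism M (C m) sgn_module G ract cobar_act sgn_act (word_coeff (vars n))"
  using G by (intro tensor_morphismI pair_C pair_sgn)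
    (auto simp: equivariant_maps_def linear_maps_def sgn_module_def word_coeff_linear
      word_coeff_vars_cobar_act subset_iff [of G] simp del: upt_Suc One_nat_def)

lemma morphism_alternating:
  "tensor_morphism M sgn_module (C n) G ract sgn_act cobar_act (\<lambda>c. scale c (alternating_word n))"
proof (intro tensor_morphismI pair_C pair_sgn)
  have "scale (sgn_act \<sigma> c) (alternating_word n) = cobar_act \<sigma> (scale c (alternating_word n))"
    if "\<sigma> \<in> G" for \<sigma> and c :: 'k
    using cobar_act_alternating_word [OF subsetD [OF G that], where 'a = 'k]
    by (simp add: cobar_act_linear scale_scale sgn_act_def mult.commute)
  moreover have "Poly_Mapping.keys (scale c (alternating_word n)) \<subseteq> words n n" for c :: 'k
    by (intro keys_scale_subset keys_alternating_word)
  ultimately show "(\<lambda>c. scale c (alternating_word n)) \<in>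
      equivariant_maps G sgn_module sgn_act (C n) cobar_act"
    by (simp add: equivariant_maps_def linear_maps_def sgn_module_def scale_add scale_scale)
qed

lemmas D_linear = tensor_morphism.tensored_linear [OF morphism_diff]
lemmas htp_linear = tensor_morphism.tensored_linear [OF morphism_htp]
lemmas coeff_linear = tensor_morphism.tensored_linear [OF morphism_coeff]
lemmas alternating_linear = tensor_morphism.tensored_linear [OF morphism_alternating]

text \<open>Functoriality and additivity turn the chain-level sum into a sum of induced composites;
  the degree is positive because the homotopy lands one degree lower.\<close>

lemma sum_eq:
  assumes "Q \<in> carrier (N (Suc j))"
  shows "group_tensor_map G M ract (C (Suc j)) cobar_act
      (\<lambda>p. cobar_diff (equivariant_htp n p) + equivariant_htp n (cobar_diff p)) Q =
    D j (tensor_htp j Q) \<oplus>\<^bsub>N (Suc j)\<^esub> tensor_htp (Suc j) (D (Suc j) Q)"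
  using group_tensor_map_add [OF morphism_diff_htp morphism_htp_diff morphism_sum _ assms]
    group_tensor_map_compose [OF morphism_htp morphism_diff morphism_diff_htp _ assms]
    group_tensor_map_compose [OF morphism_diff morphism_htp morphism_htp_diff _ assms]
  by simp

lemma exact_off_degree:
  assumes "m \<noteq> n" "Q \<in> carrier (N m)" "D m Q = \<zero>\<^bsub>N (Suc m)\<^esub>"
  shows "Q \<in> coboundaries N D m"
proof (cases m)
  case 0
  \<comment> \<open>The empty word has multidegree 0, not (1, ..., 1), as n \<ge> 1. Hence the
    identity in degree 0 is also the zero map.\<close>
  have "words n 0 = {}"
    using n lookup_all_ones [of n 1] by (auto simp: words_def)
  then have "Q = \<zero>\<^bsub>N m\<^esub>"
    using group_tensor_map_id [OF morphism_id _ assms(2)] group_tensor_map_zero [OF morphism_id _ assms(2)] 0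
    by simp
  with 0 show ?thesis by (simp add: coboundaries_def)
next
  case (Suc j)
  interpret N: module ring_of_type_algebra "N m" by (rule module_N)
  \<comment> \<open>The projection term vanishes, since the functional sees only words of length
    n.\<close>
  have "cobar_diff (equivariant_htp n p) + equivariant_htp n (cobar_diff p) = p"
    if "p \<in> carrier (C m)" for p
    using that equivariant_htp_cobar_diff [of p n m] word_coeff_vars_eq_0 [of p n m] assms(1)
    by (simp del: upt_Suc One_nat_def)
  then have "Q = group_tensor_map G M ract (C m) cobar_act
      (\<lambda>p. cobar_diff (equivariant_htp n p) + equivariant_htp n (cobar_diff p)) Q"
    using group_tensor_map_id [OF morphism_sum [of j] _ assms(2) [unfolded Suc]] by (simp add: Suc)
  also have "\<dots> = D j (tensor_htp j Q) \<oplus>\<^bsub>N m\<^esub> \<zero>\<^bsub>N m\<^esub>"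
    using sum_eq [OF assms(2) [unfolded Suc]] assms(3)
      linear_maps_zero [OF module_N module_N htp_linear, of "Suc j"] by (simp add: Suc)
  also have "\<dots> = D j (tensor_htp j Q)"
  proof -
    have "D j (tensor_htp j Q) \<in> carrier (N m)"
      using linear_maps_closed [OF D_linear linear_maps_closed [OF htp_linear assms(2) [unfolded Suc]]]
      by (simp add: Suc)
    then show ?thesis by simp
  qed
  finally show ?thesis
    using linear_maps_closed [OF htp_linear assms(2) [unfolded Suc]]
    by (simp add: coboundaries_def Suc)
qed

lemma exact_in_degree:
  assumes Q: "Q \<in> carrier (N n)" and "D n Q = \<zero>\<^bsub>N (Suc n)\<^esub>" "tensor_coeff Q = \<zero>\<^bsub>T\<^esub>"
  shows "Q \<in> coboundaries N D n"
proof -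
  obtain j where j: "n = Suc j" using n by (cases n) auto
  interpret N: module ring_of_type_algebra "N n" by (rule module_N)
  let ?s = "\<lambda>p. cobar_diff (equivariant_htp n p) + equivariant_htp n (cobar_diff p)"
  have s: "tensor_morphism M (C n) (C n) G ract cobar_act cobar_act ?s"
    using morphism_sum [of j] by (simp flip: j)
  have p: "tensor_morphism M (C n) (C n) G ract cobar_act cobar_act
      (\<lambda>p. scale (word_coeff (vars n) p) (alternating_word n))"
    using word_coeff_vars_cobar_act cobar_act_alternating_word [of _ n, where 'a = 'k]
    by (intro morphism_C_C keys_scale_subset keys_alternating_word)
      (simp_all add: word_coeff_linear scale_add scale_scale cobar_act_linear sgn_act_def mult.commute
        del: upt_Suc One_nat_def)
  have "p = ?s p \<oplus>\<^bsub>C n\<^esub> scale (word_coeff (vars n) p) (alternating_word n)" if "p \<in> carrier (C n)" for p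
    using that equivariant_htp_cobar_diff [of p n n] by (simp del: upt_Suc One_nat_def)
  then have "Q = group_tensor_map G M ract (C n) cobar_act ?s Q \<oplus>\<^bsub>N n\<^esub>
      group_tensor_map G M ract (C n) cobar_act (\<lambda>p. scale (word_coeff (vars n) p) (alternating_word n)) Q"
    using group_tensor_map_add [OF s p morphism_id _ Q] group_tensor_map_id [OF morphism_id _ Q] by simp
  \<comment> \<open>The projection factors through the sign module, so the hypothesis on
    \<open>tensor_coeff\<close> kills it.\<close>
  also have "group_tensor_map G M ract (C n) cobar_act
      (\<lambda>p. scale (word_coeff (vars n) p) (alternating_word n)) Q = alternating (tensor_coeff Q)"
    by (rule group_tensor_map_compose [OF morphism_coeff morphism_alternating p _ Q, symmetric]) simp
  also have "\<dots> = \<zero>\<^bsub>N n\<^esub>"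
    unfolding assms(3) by (rule linear_maps_zero [OF module_T module_N alternating_linear])
  also have "group_tensor_map G M ract (C n) cobar_act ?s Q = D j (tensor_htp j Q) \<oplus>\<^bsub>N n\<^esub> \<zero>\<^bsub>N n\<^esub>"
    using sum_eq [of Q j] Q assms(2) linear_maps_zero [OF module_N module_N htp_linear, of n]
    by (simp flip: j)
  finally have "Q = D j (tensor_htp j Q) \<oplus>\<^bsub>N n\<^esub> \<zero>\<^bsub>N n\<^esub> \<oplus>\<^bsub>N n\<^esub> \<zero>\<^bsub>N n\<^esub>" .
  moreover have htp: "tensor_htp j Q \<in> carrier (N j)"
    using linear_maps_closed [OF htp_linear, of Q j] Q by (simp flip: j)
  moreover have "D j (tensor_htp j Q) \<in> carrier (N n)"
    using linear_maps_closed [OF D_linear htp] by (simp flip: j)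
  ultimately have "Q = D j (tensor_htp j Q)" by simp
  with htp show ?thesis
    by (simp add: coboundaries_def j)
qed

lemma submodule_coboundaries: "submodule (coboundaries N D m) ring_of_type_algebra (N m)"
  unfolding coboundaries_def
  by (cases m) (auto intro!: submodule_zero submodule_image module_N D_linear)

lemma coeff_coboundary:
  assumes "Q \<in> coboundaries N D n"
  shows "tensor_coeff Q = \<zero>\<^bsub>T\<^esub>"
proof -
  obtain j where j: "n = Suc j" using n by (cases n) auto
  obtain R where R: "R \<in> carrier (N j)" "Q = D j R"
    using assms by (auto simp: coboundaries_def j)
  have z: "tensor_morphism M (C j) sgn_module G ract cobar_act sgn_act (\<lambda>p. 0)"
    by (intro tensor_morphismI pair_C pair_sgn)
      (simp add: equivariant_maps_def linear_maps_def sgn_module_def sgn_act_def)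
  have "tensor_coeff Q = group_tensor_map G M ract sgn_module sgn_act (\<lambda>p. 0) R"
    unfolding R(2)
    by (rule group_tensor_map_compose [OF morphism_diff morphism_coeff z _ R(1)])
      (simp add: word_coeff_vars_cobar_diff del: upt_Suc One_nat_def)
  also have "\<dots> = \<zero>\<^bsub>T\<^esub>"
    by (rule group_tensor_map_zero [OF z _ R(1)]) (simp add: sgn_module_def)
  finally show ?thesis .
qed

lemma D_alternating:
  assumes "t \<in> carrier T"
  shows "D n (alternating t) = \<zero>\<^bsub>N (Suc n)\<^esub>"
proof -
  have z: "tensor_morphism M sgn_module (C (Suc n)) G ract sgn_act cobar_act (\<lambda>c. 0)"
    by (intro tensor_morphismI pair_C pair_sgn)
      (simp add: equivariant_maps_def linear_maps_def cobar_act_linear)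
  have "D n (alternating t) = group_tensor_map G M ract (C (Suc n)) cobar_act (\<lambda>c. 0) t"
    by (rule group_tensor_map_compose [OF morphism_alternating morphism_diff z _ assms])
      (simp add: cobar_diff_linear cobar_diff_alternating_word)
  also have "\<dots> = \<zero>\<^bsub>N (Suc n)\<^esub>"
    by (rule group_tensor_map_zero [OF z _ assms]) simp
  finally show ?thesis .
qed

lemma coeff_alternating:
  assumes "t \<in> carrier T"
  shows "tensor_coeff (alternating t) = t"
proof -
  have id: "tensor_morphism M sgn_module sgn_module G ract sgn_act sgn_act (\<lambda>c. c)"
    by (intro tensor_morphismI pair_sgn) (simp add: equivariant_maps_def linear_maps_def)
  have "tensor_coeff (alternating t) = group_tensor_map G M ract sgn_module sgn_act (\<lambda>c. c) t"
    by (rule group_tensor_map_compose [OF morphism_alternating morphism_coeff id _ assms])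
      (simp add: word_coeff_linear word_coeff_alternating_word del: upt_Suc One_nat_def)
  also have "\<dots> = t"
    by (rule group_tensor_map_id [OF id _ assms]) simp
  finally show ?thesis .
qed

text \<open>In degree n the isomorphism is induced by \<open>tensor_coeff\<close>: it kills
  coboundaries, \<open>alternating\<close> is a section with values in cocycles, and a cocycle in
  its kernel is a coboundary. In other degrees all cocycles are coboundaries and the zero map
  serves.\<close>

lemma cohomology_iso: "linearly_isomorphic (cohomology N D m) (concentrated_in n T m)"
proof -
  interpret N: module ring_of_type_algebra "N m" by (rule module_N)
  interpret N': module ring_of_type_algebra "N (Suc m)" by (rule module_N)
  interpret T: module ring_of_type_algebra T by (rule module_T)
  define Z where "Z = a_kernel (N m) (N (Suc m)) (D m)"
  have Z: "Q \<in> Z \<longleftrightarrow> Q \<in> carrier (N m) \<and> D m Q = \<zero>\<^bsub>N (Suc m)\<^esub>" for Q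
    by (simp add: Z_def a_kernel_def')
  have Z_sub: "Z \<subseteq> carrier (N m)"
    using Z by blast
  have Z_add: "P \<oplus>\<^bsub>N m\<^esub> Q \<in> Z" if "P \<in> Z" "Q \<in> Z" for P Q
    using that by (simp add: Z linear_maps_add [OF D_linear])
  have Z_smult: "c \<odot>\<^bsub>N m\<^esub> Q \<in> Z" if "Q \<in> Z" for c Q
    using that N.smult_closed [of c Q] N'.smult_r_null [of c]
    by (simp add: Z linear_maps_smult [OF D_linear])
  have Z_minus: "P \<ominus>\<^bsub>N m\<^esub> Q \<in> Z" if "P \<in> Z" "Q \<in> Z" for P Q
    using that by (simp add: Z linear_maps_minus [OF module_N module_N D_linear])
      (simp add: a_minus_def)
  have W_sub: "coboundaries N D m \<subseteq> carrier (N m)"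
    using N.submoduleE(1) [OF submodule_coboundaries] .
  have "linearly_isomorphic (quotient_module ((N m)\<lparr>carrier := Z\<rparr>) (coboundaries N D m))
      (concentrated_in n T m)"
  proof (cases "m = n")
    case True
    note cT = linear_maps_closed [OF coeff_linear]
    have T_eq: "concentrated_in n T m = T" by (simp add: concentrated_in_def True)
    show ?thesis
      unfolding T_eq
    proof (rule linearly_isomorphic_quotient [OF module_N submodule_coboundaries Z_sub Z_add Z_smult])
      show "tensor_coeff (P \<oplus>\<^bsub>N m\<^esub> Q) = tensor_coeff P \<oplus>\<^bsub>T\<^esub> tensor_coeff Q" if "P \<in> Z" "Q \<in> Z" for P Q
        using that Z_sub by (intro linear_maps_add [OF coeff_linear]) auto
      show "tensor_coeff (c \<odot>\<^bsub>N m\<^esub> Q) = c \<odot>\<^bsub>T\<^esub> tensor_coeff Q" if "Q \<in> Z" for c Q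
        using that Z_sub by (intro linear_maps_smult [OF coeff_linear]) auto
      show "tensor_coeff (P \<oplus>\<^bsub>N m\<^esub> Q) = tensor_coeff Q" if "P \<in> coboundaries N D m" "Q \<in> Z" for P Q
        using that Z_sub W_sub coeff_coboundary [of P] cT [of Q m] True
        by (subst linear_maps_add [OF coeff_linear]) auto
      show "tensor_coeff ` Z = carrier T"
      proof
        show "tensor_coeff ` Z \<subseteq> carrier T" using cT Z_sub by blast
        show "carrier T \<subseteq> tensor_coeff ` Z"
        proof
          fix t assume t: "t \<in> carrier T"
          then have "alternating t \<in> Z"
            unfolding Z True using linear_maps_closed [OF alternating_linear t] D_alternating by blast
          then show "t \<in> tensor_coeff ` Z"
            using coeff_alternating [OF t] by (metis imageI)
        qed
      qed
      show "P \<ominus>\<^bsub>N m\<^esub> Q \<in> coboundaries N D m" if "P \<in> Z" "Q \<in> Z" "tensor_coeff P = tensor_coeff Q" for P Q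
      proof -
        have PQ: "P \<in> carrier (N m)" "Q \<in> carrier (N m)" using that Z_sub by auto
        have "tensor_coeff (P \<ominus>\<^bsub>N m\<^esub> Q) = \<zero>\<^bsub>T\<^esub>"
          using linear_maps_minus [OF module_N module_T coeff_linear PQ] that(3) cT [OF PQ(2)]
          by (simp add: a_minus_def T.M.r_neg)
        then show ?thesis
          using Z_minus [OF that(1,2)] exact_in_degree [of "P \<ominus>\<^bsub>N m\<^esub> Q"] by (simp add: Z True)
      qed
    qed
  next
    case False
    have T_eq: "concentrated_in n T m = T\<lparr>carrier := {\<zero>\<^bsub>T\<^esub>}\<rparr>"
      by (simp add: concentrated_in_def False)
    have zero: "\<zero>\<^bsub>N m\<^esub> \<in> Z"
      using linear_maps_zero [OF module_N module_N D_linear] by (simp add: Z)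
    show ?thesis
      unfolding T_eq
    proof (rule linearly_isomorphic_quotient [OF module_N submodule_coboundaries Z_sub Z_add Z_smult,
          where \<Phi> = "\<lambda>Q. \<zero>\<^bsub>T\<^esub>"])
      show "P \<ominus>\<^bsub>N m\<^esub> Q \<in> coboundaries N D m" if "P \<in> Z" "Q \<in> Z" for P Q
        using Z_minus [OF that] exact_off_degree [OF False] by (simp add: Z)
    qed (use zero T.smult_r_null in auto)
  qed
  then show ?thesis by (simp add: cohomology_def Z_def)
qed

end

theorem corollary1:
  fixes n :: nat
    and G :: "(nat \<Rightarrow> nat) set"
    and M :: "('k::field_char_0, 'm) module"
    and ract :: "'m \<Rightarrow> (nat \<Rightarrow> nat) \<Rightarrow> 'm"
  assumes "n \<ge> 1"
    and "subgroup G (sym_group n)"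
    and "right_group_module ((sym_group n)\<lparr>carrier := G\<rparr>) M ract"
  shows "\<forall>m. linearly_isomorphic
           (cohomology (Cub n G M ract) (Cub_diff n G M ract) m)
           (concentrated_in n (group_tensor G M ract sgn_module sgn_act) m)"
proof -
  interpret right_group_module "(sym_group n)\<lparr>carrier := G\<rparr>" M ract by fact
  interpret cubical n G M ract
  proof (rule cubical.intro)
    show "G \<subseteq> perms n"
      using subgroup.subset [OF assms(2)] by (auto simp: sym_group_carrier)
    show "module ring_of_type_algebra M" by (rule module_axioms)
    show "ract x g \<in> carrier M" if "x \<in> carrier M" "g \<in> G" for x g
      using ract_linear [of g] that by (auto dest: linear_maps_closed)
  qed (fact assms(1))
  show ?thesis
    unfolding Cub_eq Cub_diff_eq using cohomology_iso by blast
qed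

end
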